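(* Let $n_1=n_2=1$, let $\Omega=I_1\times I_2\subset\mathbb{R}^2$ be a nonempty bounded open box, assume $\theta<1$, and let $u\in L^\infty(\Omega)$ with $\mathcal{E}(u)<\infty$. Then there exist (at most countably many) points $x^j\in\Omega$ and numbers $m_j\in\mathbb{R}\setminus\{0\}$ such that $\mu[u]=\sum_{j\ge1}m_j\delta_{x^j}$, and $$\sum_{j\ge1}|m_j|^\theta\lesssim\mathcal{E}(u).$$ If moreover $u$ is integer-valued, then all $m_j$ are integers.
   Context: Setting: $\theta_1,\theta_2>0$ with $\theta=\theta_1+\theta_2\le1$; $\rho\in L^1(\mathbb{R}^2,\mathbb{R}_+)$ is radial, supported in the unit ball $B_1$, with $\int\rho=1$, and $\rho_\varepsilon(z)=\varepsilon^{-2}\rho(z/\varepsilon)$. For $z=(z_1,z_2)$ write $z_1$ also for $(z_1,0)$, $z_2$ for $(0,z_2)$. $Du(x,z):=u(x+z)-u(x)$. $I_l^\varepsilon=\{s\in I_l:\operatorname{dist}(s,\mathbb{R}\setminus I_l)>\varepsilon\}$, $\Omega^\varepsilon=I_1^\varepsilon\times I_2^\varepsilon$. $$\mathcal{E}_\varepsilon(u)=\int_{\mathbb{R}^2}\int_{\Omega^\varepsilon}\frac{|Du(x,z_1)|^{\theta_1}|Du(x,z_2)|^{\theta_2}}{|z|^2}\,dx\,\rho_\varepsilon(z)\,dz,\qquad\mathcal{E}(u)=\liminf_{\varepsilon\downarrow0}\mathcal{E}_\varepsilon(u).$$ $\mu[u]=\partial_1\partial_2u$ (distributional). $a\lesssim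 b$ means $a\le Cb$ with $C$ depending only on $\theta_1,\theta_2,\rho$. *)

theory Defs
  imports "HOL-Analysis.Analysis"
begin

text \<open>Points of the plane are pairs of reals; the norm on real \<times> real is Euclidean.\<close>

definition pd :: "bool \<Rightarrow> (real \<times> real \<Rightarrow> real) \<Rightarrow> (real \<times> real \<Rightarrow> real)" where
  "pd b f = (\<lambda>x. if b then deriv (\<lambda>t. f (t, snd x)) (fst x)
                       else deriv (\<lambda>t. f (fst x, t)) (snd x))"

fun pds :: "bool list \<Rightarrow> (real \<times> real \<Rightarrow> real) \<Rightarrow> (real \<times> real \<Rightarrow> real)" where
  "pds [] f = f"
| "pds (b # bs) f = pd b (pds bs f)"

definition smooth2 :: "(real \<times> real \<Rightarrow> real) \<Rightarrow> bool" where
  "smooth2 f \<longleftrightarrow> (\<forall>bs. continuous_on UNIV (pds bs f) \<and>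
      (\<forall>x. (\<lambda>t. pds bs f (t, snd x)) differentiable (at (fst x)) \<and>
           (\<lambda>t. pds bs f (fst x, t)) differentiable (at (snd x))))"

definition test_fun :: "(real \<times> real) set \<Rightarrow> (real \<times> real \<Rightarrow> real) \<Rightarrow> bool" where
  "test_fun \<Omega> \<phi> \<longleftrightarrow> smooth2 \<phi> \<and> (\<exists>K. compact K \<and> K \<subseteq> \<Omega> \<and> (\<forall>x. x \<notin> K \<longrightarrow> \<phi> x = 0))"

definition box2 :: "real \<Rightarrow> real \<Rightarrow> real \<Rightarrow> real \<Rightarrow> (real \<times> real) set" where
  "box2 a1 b1 a2 b2 = {a1<..<b1} \<times> {a2<..<b2}"

definition inner_box :: "real \<Rightarrow> real \<Rightarrow> real \<Rightarrow> real \<Rightarrow> real \<Rightarrow> (real \<times> real) set" where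
  "inner_box a1 b1 a2 b2 \<epsilon> = {s. s \<in> {a1<..<b1} \<and> infdist s (- {a1<..<b1}) > \<epsilon>}
                          \<times> {s. s \<in> {a2<..<b2} \<and> infdist s (- {a2<..<b2}) > \<epsilon>}"

definition Du :: "(real \<times> real \<Rightarrow> real) \<Rightarrow> real \<times> real \<Rightarrow> real \<times> real \<Rightarrow> real" where
  "Du u x z = u (x + z) - u x"

definition rho_eps :: "(real \<times> real \<Rightarrow> real) \<Rightarrow> real \<Rightarrow> real \<times> real \<Rightarrow> real" where
  "rho_eps \<rho> \<epsilon> z = \<rho> ((1 / \<epsilon>) *\<^sub>R z) / \<epsilon>\<^sup>2"

definition E_eps :: "real \<Rightarrow> real \<Rightarrow> (real \<times> real \<Rightarrow> real) \<Rightarrow> real \<Rightarrow> real \<Rightarrow> real \<Rightarrow> real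
    \<Rightarrow> (real \<times> real \<Rightarrow> real) \<Rightarrow> real \<Rightarrow> ennreal" where
  "E_eps \<theta>1 \<theta>2 \<rho> a1 b1 a2 b2 u \<epsilon> =
     (\<integral>\<^sup>+ z. (\<integral>\<^sup>+ x. indicator (inner_box a1 b1 a2 b2 \<epsilon>) x *
         ennreal (\<bar>Du u x (fst z, 0)\<bar> powr \<theta>1 * \<bar>Du u x (0, snd z)\<bar> powr \<theta>2 / (norm z)\<^sup>2) \<partial>lborel)
       * ennreal (rho_eps \<rho> \<epsilon> z) \<partial>lborel)"

definition E_lim :: "real \<Rightarrow> real \<Rightarrow> (real \<times> real \<Rightarrow> real) \<Rightarrow> real \<Rightarrow> real \<Rightarrow> real \<Rightarrow> real
    \<Rightarrow> (real \<times> real \<Rightarrow> real) \<Rightarrow> ennreal" where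
  "E_lim \<theta>1 \<theta>2 \<rho> a1 b1 a2 b2 u = Liminf (at_right 0) (E_eps \<theta>1 \<theta>2 \<rho> a1 b1 a2 b2 u)"

end

theory Submission
  imports Defs "HOL-Complex_Analysis.Great_Picard"
begin

text \<open>For a rectangle with corners \<open>x\<close>, \<open>x + z\<^sub>1\<close>, \<open>x + z\<^sub>2\<close>, \<open>x + z\<close>, the \<open>\<theta>\<close>-th power of its
  \<open>\<mu>[u]\<close>-mass is controlled by the integrand of the energy at the four corners. Averaging over
  \<open>z\<close> and over the offset of a lattice of rectangles therefore gives, at each of a sequence of
  scales tending to zero, a discretisation of \<open>\<mu>[u]\<close> by finitely many atoms whose
  \<open>\<theta>\<close>-masses sum to at most a constant times the energy. The offset can be chosen so that, by
  continuity of translations in \<open>L\<^sup>1\<close> and summation by parts, these atomic measures converge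
  to \<open>\<mu>[u]\<close> as distributions. Since \<open>\<theta> < 1\<close>, the bound on the \<open>\<theta>\<close>-masses makes the \<open>j\<close>-th largest atom
  at most \<open>(K / (j + 1)) powr (1 / \<theta>)\<close>, which is summable: no mass can spread out, and the limit is atomic.\<close>

section \<open>Limits of atomic measures\<close>

text \<open>Sums of samples, one per lattice cell, are integrals over x divided by the cell area
  \<open>|z1 z2|\<close>, whereas the energy offers the weight \<open>1 / |z|^2\<close>; the two are
  comparable only away from the axes. As the axes are null and \<rho> has positive mass, some cone
  \<open>|z1 z2| > c |z|^2\<close> carries mass at least \<kappa>, and by scaling the same
  \<open>c\<close> and \<kappa> serve every \<epsilon>. The constant
  \<open>48 / (\<kappa> * c)\<close> is 4 (one view per corner, equally weighted as \<rho> is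
  radial) times 2 (slack in selecting the steps) times 2 (corner inequality) times 3 (selecting the
  offset).

  Since \<open>u\<close> is only bounded and measurable, sampling it at lattice points is meaningful
  for suitable offsets only: one offset must be good at once for the energy, for the sampling error
  and for avoiding the null set on which \<open>u\<close> may fail to be an integer. In the limit
  atoms may collide, where subadditivity of \<open>t powr \<theta>\<close> preserves the bound, or
  reach the boundary, where test functions vanish.\<close>

lemma powr_add_le:
  fixes a b p :: real
  assumes "0 \<le> a" "0 \<le> b" "0 < p" "p \<le> 1"
  shows "(a + b) powr p \<le> a powr p + b powr p"
proof (cases "a + b = 0")
  case True
  then show ?thesis using assms by simp
next
  case False
  define s where "s = a + b"
  have s: "s > 0" using False assms by (simp add: s_def)
  \<comment> \<open>After division by the sum both terms lie in [0, 1], where raising to a power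
    \<open>p <= 1\<close> can only increase.\<close>
  have *: "t \<le> t powr p" if "0 \<le> t" "t \<le> 1" for t :: real
    using powr_mono'[of p 1 t] that assms by (cases "t = 0") auto
  have "1 = a / s + b / s"
    using s by (simp add: s_def flip: add_divide_distrib)
  also have "\<dots> \<le> (a / s) powr p + (b / s) powr p"
    using assms s by (intro add_mono *) (auto simp: s_def)
  also have "\<dots> = (a powr p + b powr p) / s powr p"
    using assms s by (simp add: powr_divide add_divide_distrib)
  finally show ?thesis
    using s by (simp add: s_def field_simps)
qed

lemma abs_sum_powr_le:
  fixes f :: "'a \<Rightarrow> real"
  assumes "finite F" "0 < p" "p \<le> 1"
  shows "\<bar>sum f F\<bar> powr p \<le> (\<Sum>i\<in>F. \<bar>f i\<bar> powr p)"
  using assms(1)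
proof (induction F rule: finite_induct)
  case empty
  then show ?case by simp
next
  case (insert x F)
  have "\<bar>f x + sum f F\<bar> powr p \<le> (\<bar>f x\<bar> + \<bar>sum f F\<bar>) powr p"
    using assms by (intro powr_mono2) auto
  also have "\<dots> \<le> \<bar>f x\<bar> powr p + \<bar>sum f F\<bar> powr p"
    using assms by (intro powr_add_le) auto
  finally show ?case
    using insert by simp
qed

text \<open>Needed because infinitely many limiting atoms may share a position. The finite
  inequality survives the limit over finite subsets, each of whose \<open>p\<close>-sums is at most
  the full one.\<close>

lemma abs_infsum_powr_le:
  fixes f :: "'a \<Rightarrow> real"
  assumes "f summable_on A" "(\<lambda>i. \<bar>f i\<bar> powr p) summable_on A" "0 < p" "p \<le> 1"
  shows "\<bar>infsum f A\<bar> powr p \<le> infsum (\<lambda>i. \<bar>f i\<bar> powr p) A"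
proof (rule tendsto_upperbound)
  have "(sum f \<longlongrightarrow> infsum f A) (finite_subsets_at_top A)"
    using assms(1) by (rule infsum_tendsto)
  then show "((\<lambda>F. \<bar>sum f F\<bar> powr p) \<longlongrightarrow> \<bar>infsum f A\<bar> powr p) (finite_subsets_at_top A)"
    using assms by (intro tendsto_powr' tendsto_rabs tendsto_const) auto
  show "\<forall>\<^sub>F F in finite_subsets_at_top A. \<bar>sum f F\<bar> powr p \<le> infsum (\<lambda>i. \<bar>f i\<bar> powr p) A"
  proof (rule eventually_finite_subsets_at_top_weakI)
    fix F assume F: "finite F" "F \<subseteq> A"
    have "\<bar>sum f F\<bar> powr p \<le> (\<Sum>i\<in>F. \<bar>f i\<bar> powr p)"
      using F assms by (intro abs_sum_powr_le)
    also have "\<dots> \<le> infsum (\<lambda>i. \<bar>f i\<bar> powr p) A"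
      using F assms by (intro finite_sum_le_infsum) auto
    finally show "\<bar>sum f F\<bar> powr p \<le> infsum (\<lambda>i. \<bar>f i\<bar> powr p) A" .
  qed
qed simp

text \<open>The integers are closed, and finite partial sums stay in them.\<close>

lemma infsum_in_Ints:
  fixes f :: "'a \<Rightarrow> real"
  assumes "f summable_on A" "\<And>i. i \<in> A \<Longrightarrow> f i \<in> \<int>"
  shows "infsum f A \<in> \<int>"
proof (rule Lim_in_closed_set)
  show "(sum f \<longlongrightarrow> infsum f A) (finite_subsets_at_top A)"
    using assms(1) by (rule infsum_tendsto)
  show "\<forall>\<^sub>F F in finite_subsets_at_top A. sum f F \<in> \<int>"
    using assms(2) by (intro eventually_finite_subsets_at_top_weakI Ints_sum) auto
qed auto

text \<open>A Chebyshev argument: entry \<open>j\<close> is preceded by \<open>j\<close> entries at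
  least as large, so \<open>j + 1\<close> copies of its \<open>p\<close>-th power fit under
  \<open>K\<close>. The bound depends on the rank alone and hence can dominate all scales at
  once.\<close>

lemma decreasing_enumeration:
  fixes w :: "'i \<Rightarrow> real"
  assumes "finite S" "0 < p" "(\<Sum>i\<in>S. \<bar>w i\<bar> powr p) \<le> K"
  obtains xs where "distinct xs" "set xs = S"
    "\<And>j. j < length xs \<Longrightarrow> \<bar>w (xs ! j)\<bar> \<le> (K / (real j + 1)) powr (1 / p)"
proof -
  obtain ys where ys: "set ys = S" "distinct ys"
    using finite_distinct_list[OF assms(1)] by blast
  \<comment> \<open>\<open>sort_key\<close> sorts increasingly, so the negated modulus puts the
    largest atom first.\<close>
  define xs where "xs = sort_key (\<lambda>i. - \<bar>w i\<bar>) ys"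
  have xs: "set xs = S" "distinct xs"
    using ys by (auto simp: xs_def)
  have srt: "sorted (map (\<lambda>i. - \<bar>w i\<bar>) xs)"
    by (simp add: xs_def)
  have "\<bar>w (xs ! j)\<bar> \<le> (K / (real j + 1)) powr (1 / p)" if j: "j < length xs" for j
  proof -
    have le: "\<bar>w (xs ! j)\<bar> \<le> \<bar>w (xs ! i)\<bar>" if "i \<le> j" for i
      using sorted_nth_mono[OF srt, of i j] that j by simp
    have "(real j + 1) * \<bar>w (xs ! j)\<bar> powr p = (\<Sum>i\<le>j. \<bar>w (xs ! j)\<bar> powr p)"
      by simp
    also have "\<dots> \<le> (\<Sum>i\<le>j. \<bar>w (xs ! i)\<bar> powr p)"
      using le assms(2) by (intro sum_mono powr_mono2) auto
    also have "\<dots> = sum (\<lambda>x. \<bar>w x\<bar> powr p) ((!) xs ` {..j})"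
      using xs(2) j by (subst sum.reindex) (auto intro!: inj_onI simp: nth_eq_iff_index_eq)
    also have "\<dots> \<le> (\<Sum>i\<in>S. \<bar>w i\<bar> powr p)"
      using xs j assms(1) by (intro sum_mono2) auto
    also note assms(3)
    finally have "\<bar>w (xs ! j)\<bar> powr p \<le> K / (real j + 1)"
      by (simp add: field_simps)
    then have "(\<bar>w (xs ! j)\<bar> powr p) powr (1 / p) \<le> (K / (real j + 1)) powr (1 / p)"
      using assms(2) by (intro powr_mono2) auto
    then show ?thesis
      using assms(2) by (simp add: powr_powr)
  qed
  then show ?thesis
    using that xs by blast
qed

text \<open>Strictness of \<open>p < 1\<close> enters here: the exponent \<open>1 / p\<close> then
  exceeds 1.\<close>

lemma summable_powr_tail:
  fixes p :: real
  assumes "0 < p" "p < 1" "0 \<le> K"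
  shows "summable (\<lambda>j. (K / (real j + 1)) powr (1 / p))"
proof -
  have "summable (\<lambda>j. real j powr (- (1 / p)))"
    using assms by (subst summable_real_powr_iff) (auto simp: field_simps)
  then have "summable (\<lambda>j. real (Suc j) powr (- (1 / p)))"
    by (subst summable_Suc_iff)
  then have "summable (\<lambda>j. K powr (1/p) * real (Suc j) powr (- (1 / p)))"
    by (rule summable_mult)
  moreover have "(K / (real j + 1)) powr (1 / p) = K powr (1/p) * real (Suc j) powr (- (1 / p))" for j
    using assms by (simp add: powr_divide powr_minus_divide add.commute)
  ultimately show ?thesis
    by simp
qed

text \<open>Compactness for atoms ordered by size: a diagonal subsequence makes position and weight
  of every rank converge, and the common summable majorant keeps mass from escaping into high ranks.
  The pairings are assumed to converge along the whole sequence, so a subsequence identifies their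
  limit. The bound \<open>K k\<close> varies with \<open>k\<close> so that the limit inherits
  \<open>K0\<close>. The limit positions need not lie in \<Omega>.\<close>

lemma atomic_weak_limit:
  fixes S :: "nat \<Rightarrow> 'i set" and w :: "nat \<Rightarrow> 'i \<Rightarrow> real"
    and P :: "nat \<Rightarrow> 'i \<Rightarrow> 'b :: euclidean_space"
  assumes p: "0 < p" "p < 1"
    and fin: "\<And>k. finite (S k)"
    and K: "\<And>k. (\<Sum>i\<in>S k. \<bar>w k i\<bar> powr p) \<le> K k" "K \<longlonglongrightarrow> K0"
    and \<Omega>: "bounded \<Omega>" "\<And>k i. i \<in> S k \<Longrightarrow> P k i \<in> \<Omega>"
  obtains a :: "nat \<Rightarrow> real" and q :: "nat \<Rightarrow> 'b"
  where "summable (\<lambda>j. \<bar>a j\<bar>)" "summable (\<lambda>j. \<bar>a j\<bar> powr p)" "(\<Sum>j. \<bar>a j\<bar> powr p) \<le> K0"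
    "\<And>\<phi> l M. continuous_on UNIV \<phi> \<Longrightarrow> (\<And>x. \<bar>\<phi> x\<bar> \<le> M) \<Longrightarrow>
       (\<lambda>k. \<Sum>i\<in>S k. w k i * \<phi> (P k i)) \<longlonglongrightarrow> l \<Longrightarrow> (\<Sum>j. a j * \<phi> (q j)) = l"
    "\<And>j. (\<And>k i. i \<in> S k \<Longrightarrow> w k i \<in> \<int>) \<Longrightarrow> a j \<in> \<int>"
proof -
  \<comment> \<open>\<open>K k\<close> itself is kept for the final estimate; the majorant needs one
    bound for all \<open>k\<close>.\<close>
  obtain Kb where Kb: "\<And>k. K k \<le> Kb" "Kb \<ge> 0"
  proof -
    have "Bseq K"
      using K(2) convergentI convergent_imp_Bseq by blast
    then obtain B where "B > 0" "\<And>k. norm (K k) \<le> B"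
      by (auto simp: Bseq_def)
    then show ?thesis
      using that[of B] by (metis abs_le_D1 less_imp_le real_norm_def)
  qed
  obtain B where B: "\<And>x. x \<in> \<Omega> \<Longrightarrow> norm x \<le> B" "B \<ge> 0"
    using \<Omega>(1) by (metis bounded_pos less_imp_le)
  have "\<exists>xs. distinct xs \<and> set xs = S k \<and>
      (\<forall>j<length xs. \<bar>w k (xs ! j)\<bar> \<le> (Kb / (real j + 1)) powr (1 / p))" for k
    using decreasing_enumeration[OF fin p(1) order_trans[OF K(1) Kb(1)], of k] by metis
  then obtain xs where xs: "\<And>k. distinct (xs k)" "\<And>k. set (xs k) = S k"
      "\<And>k j. j < length (xs k) \<Longrightarrow> \<bar>w k (xs k ! j)\<bar> \<le> (Kb / (real j + 1)) powr (1 / p)"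
    by metis
  \<comment> \<open>Missing ranks are padded by weight 0 at the origin, so that every scale becomes
    an infinite sequence of atoms.\<close>
  define A where "A k j = (if j < length (xs k) then w k (xs k ! j) else 0)" for k j
  define Q where "Q k j = (if j < length (xs k) then P k (xs k ! j) else 0)" for k j
  define D where "D j = (Kb / (real j + 1)) powr (1 / p)" for j
  have sumD: "summable D"
    unfolding D_def using p Kb by (intro summable_powr_tail)
  have AD: "\<bar>A k j\<bar> \<le> D j" for k j
    using xs(3) by (auto simp: A_def D_def)
  have D0: "D j \<le> D 0" for j
    unfolding D_def using p Kb by (intro powr_mono2) (auto simp: field_simps mult_left_mono)
  have QB: "norm (Q k j) \<le> B" for k j
  proof (cases "j < length (xs k)")
    case True
    then have "xs k ! j \<in> S k" using xs(2) nth_mem by blast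
    then show ?thesis using True \<Omega>(2) B(1) by (auto simp: Q_def)
  qed (use B in \<open>auto simp: Q_def\<close>)
  \<comment> \<open>Vanishing at weight 0 makes the padding invisible; \<open>g\<close> will be both
    the pairing with a test function and the \<open>p\<close>-th power of the weight.\<close>
  have resum: "(\<Sum>i\<in>S k. g (w k i) (P k i)) = (\<Sum>j. g (A k j) (Q k j))"
    if "\<And>x. g 0 x = 0" for g :: "real \<Rightarrow> 'b \<Rightarrow> real" and k
  proof -
    have "(\<Sum>i\<in>S k. g (w k i) (P k i)) = (\<Sum>j<length (xs k). g (w k (xs k ! j)) (P k (xs k ! j)))"
      by (rule sum.reindex_bij_betw[symmetric]) (rule bij_betw_nth[OF xs(1) refl xs(2)[symmetric]])
    also have "\<dots> = (\<Sum>j<length (xs k). g (A k j) (Q k j))"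
      by (simp add: A_def Q_def)
    also have "\<dots> = (\<Sum>j. g (A k j) (Q k j))"
      by (rule suminf_finite[symmetric]) (auto simp: A_def that)
    finally show ?thesis .
  qed
  \<comment> \<open>The diagonal argument: all coordinates are bounded by \<open>B + D 0\<close>,
    since the majorant is largest at rank 0.\<close>
  obtain r where r: "strict_mono (r :: nat \<Rightarrow> nat)"
    "\<And>j. j \<in> UNIV \<Longrightarrow> \<exists>l. (\<lambda>n. (Q (r n) j, A (r n) j)) \<longlonglongrightarrow> l"
  proof (rule function_convergent_subsequence[of "UNIV :: nat set" "\<lambda>k j. (Q k j, A k j)" "B + D 0"])
    fix k j
    have "norm (Q k j, A k j) \<le> norm (Q k j) + \<bar>A k j\<bar>"
      by (metis norm_Pair_le real_norm_def)
    also have "\<dots> \<le> B + D 0"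
      using QB AD D0 by (meson add_mono order_trans)
    finally show "norm (Q k j, A k j) \<le> B + D 0" .
  qed (auto intro: that)
  then obtain L where L: "\<And>j. (\<lambda>n. (Q (r n) j, A (r n) j)) \<longlonglongrightarrow> L j"
    by (metis UNIV_I)
  define q where "q j = fst (L j)" for j
  define a where "a j = snd (L j)" for j
  have q: "(\<lambda>n. Q (r n) j) \<longlonglongrightarrow> q j" and a: "(\<lambda>n. A (r n) j) \<longlonglongrightarrow> a j" for j
    using tendsto_fst[OF L[of j]] tendsto_snd[OF L[of j]] by (simp_all add: q_def a_def)
  have aD: "\<bar>a j\<bar> \<le> D j" for j
    by (rule tendsto_upperbound[OF tendsto_rabs[OF a]]) (use AD in auto)
  have sum_a: "summable (\<lambda>j. \<bar>a j\<bar>)"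
    by (rule summable_comparison_test'[OF sumD]) (use aD in auto)
  \<comment> \<open>Only finitely many ranks are compared, so the limit may be taken termwise;
    letting \<open>N\<close> grow afterwards gives the bound for the series, as in Fatou's
    lemma.\<close>
  have part: "(\<Sum>j<N. \<bar>a j\<bar> powr p) \<le> K0" for N
  proof (rule LIMSEQ_le)
    show "(\<lambda>n. \<Sum>j<N. \<bar>A (r n) j\<bar> powr p) \<longlonglongrightarrow> (\<Sum>j<N. \<bar>a j\<bar> powr p)"
      using p by (intro tendsto_sum tendsto_powr' tendsto_rabs a tendsto_const) auto
    show "(\<lambda>n. K (r n)) \<longlonglongrightarrow> K0"
      using LIMSEQ_subseq_LIMSEQ[OF K(2) r(1)] by (simp add: o_def)
    have "(\<Sum>j<N. \<bar>A k j\<bar> powr p) \<le> K k" for k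
    proof -
      have "(\<Sum>j<N. \<bar>A k j\<bar> powr p) \<le> (\<Sum>j. \<bar>A k j\<bar> powr p)"
        by (intro sum_le_suminf summable_finite[of "{..<length (xs k)}"]) (auto simp: A_def)
      also have "\<dots> = (\<Sum>i\<in>S k. \<bar>w k i\<bar> powr p)"
        using resum[of "\<lambda>x _. \<bar>x\<bar> powr p"] p by simp
      finally show ?thesis using K(1)[of k] by linarith
    qed
    then show "\<exists>N'. \<forall>n\<ge>N'. (\<Sum>j<N. \<bar>A (r n) j\<bar> powr p) \<le> K (r n)" by blast
  qed
  have sum_ap: "summable (\<lambda>j. \<bar>a j\<bar> powr p)"
    by (rule summableI_nonneg_bounded[of _ K0]) (use part in auto)
  show ?thesis
  proof (rule that[of a q])
    show "(\<Sum>j. \<bar>a j\<bar> powr p) \<le> K0"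
      by (rule suminf_le_const[OF sum_ap part])
  next
    fix \<phi> :: "'b \<Rightarrow> real" and l M
    assume \<phi>: "continuous_on UNIV \<phi>" "\<And>x. \<bar>\<phi> x\<bar> \<le> M"
      and lim: "(\<lambda>k. \<Sum>i\<in>S k. w k i * \<phi> (P k i)) \<longlonglongrightarrow> l"
    \<comment> \<open>Dominated convergence for series, with majorant
      \<open>D j * M\<close>.\<close>
    have "(\<lambda>n. \<Sum>j. A (r n) j * \<phi> (Q (r n) j)) \<longlonglongrightarrow> (\<Sum>j. a j * \<phi> (q j))"
    proof (rule tannerys_theorem[THEN conjunct2, THEN conjunct2])
      show "(\<lambda>n. A (r n) j * \<phi> (Q (r n) j)) \<longlonglongrightarrow> a j * \<phi> (q j)" for j
        using \<phi>(1) by (intro tendsto_mult a continuous_on_tendsto_compose[OF \<phi>(1) q]) auto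
      show "summable (\<lambda>j. D j * M)"
        by (rule summable_mult2[OF sumD])
      show "\<forall>\<^sub>F (j, n) in at_top \<times>\<^sub>F sequentially. norm (A (r n) j * \<phi> (Q (r n) j)) \<le> D j * M"
        using AD \<phi>(2) by (intro always_eventually) (auto simp: abs_mult intro!: mult_mono order_trans[OF abs_ge_zero AD])
    qed simp
    moreover have "(\<lambda>n. \<Sum>j. A (r n) j * \<phi> (Q (r n) j)) \<longlonglongrightarrow> l"
      using LIMSEQ_subseq_LIMSEQ[OF lim r(1)] resum[of "\<lambda>x y. x * \<phi> y"] by (simp add: o_def)
    ultimately show "(\<Sum>j. a j * \<phi> (q j)) = l"
      by (rule LIMSEQ_unique)
  next
    fix j
    assume int: "\<And>k i. i \<in> S k \<Longrightarrow> w k i \<in> \<int>"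
    have "A k j \<in> \<int>" for k
      using int xs(2) nth_mem by (fastforce simp: A_def)
    then show "a j \<in> \<int>"
      by (intro Lim_in_closed_set[OF _ _ _ a[of j]]) auto
  qed (use sum_a sum_ap in auto)
qed

text \<open>Distinct ranks can converge to the same point, or to a point outside \<Omega>. Summing
  over the fibres of \<open>q\<close> gives one weight per point, and discarding the fibres outside
  \<Omega> is invisible to functions vanishing there. By subadditivity neither operation increases
  the total \<open>p\<close>-mass.\<close>

lemma merge_atoms:
  fixes a :: "nat \<Rightarrow> real" and q :: "nat \<Rightarrow> 'b"
  assumes p: "0 < p" "p \<le> 1"
    and a: "summable (\<lambda>j. \<bar>a j\<bar>)" "summable (\<lambda>j. \<bar>a j\<bar> powr p)"
  obtains m :: "'b \<Rightarrow> real" where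
    "countable {x. m x \<noteq> 0}" "{x. m x \<noteq> 0} \<subseteq> \<Omega>"
    "\<And>\<phi> M. (\<And>x. \<bar>\<phi> x\<bar> \<le> M) \<Longrightarrow> (\<And>x. x \<notin> \<Omega> \<Longrightarrow> \<phi> x = 0) \<Longrightarrow>
       (\<Sum>\<^sub>\<infinity>x. m x * \<phi> x) = (\<Sum>j. a j * \<phi> (q j))"
    "(\<lambda>x. \<bar>m x\<bar> powr p) summable_on UNIV"
    "(\<Sum>\<^sub>\<infinity>x. \<bar>m x\<bar> powr p) \<le> (\<Sum>j. \<bar>a j\<bar> powr p)"
    "\<And>x. (\<And>j. a j \<in> \<int>) \<Longrightarrow> m x \<in> \<int>"
proof -
  define F where "F x = {j. q j = x}" for x
  define m where "m x = (if x \<in> \<Omega> then infsum a (F x) else 0)" for x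
  \<comment> \<open>The fibres of \<open>q\<close> partition the indices; this reindexing turns the
    sum over \<open>j\<close> into an iterated sum over points and fibres.\<close>
  have bij: "bij_betw (\<lambda>j. (q j, j)) UNIV (Sigma UNIV F)"
    by (rule bij_betwI[of _ _ _ snd]) (auto simp: F_def)
  have sumF: "f summable_on F x" if "f summable_on UNIV" for f :: "nat \<Rightarrow> real" and x
    using that by (rule summable_on_subset) auto
  have fib: "(\<Sum>\<^sub>\<infinity>x. infsum f (F x)) = (\<Sum>j. f j) \<and> (\<lambda>x. infsum f (F x)) summable_on UNIV"
    if f: "summable (\<lambda>j. \<bar>f j\<bar>)" for f :: "nat \<Rightarrow> real"
  proof -
    have fs: "f summable_on UNIV"
      by (rule norm_summable_imp_summable_on) (use f in simp)
    have s: "(\<lambda>(x, j). f j) summable_on (Sigma UNIV F)"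
      by (subst summable_on_reindex_bij_betw[OF bij, symmetric]) (use fs in simp)
    have "(\<Sum>\<^sub>\<infinity>x. infsum f (F x)) = infsum (\<lambda>(x, j). f j) (Sigma UNIV F)"
      by (rule infsum_Sigma'_banach[OF s])
    also have "\<dots> = infsum f UNIV"
      by (subst infsum_reindex_bij_betw[OF bij, symmetric]) simp
    also have "\<dots> = (\<Sum>j. f j)"
    proof -
      have "f sums infsum f UNIV"
        using fs by (intro has_sum_imp_sums) simp
      then show ?thesis by (rule sums_unique)
    qed
    finally show ?thesis
      using summable_on_Sigma_banach[OF s] by simp
  qed
  have as: "a summable_on UNIV"
    by (rule norm_summable_imp_summable_on) (use a in simp)
  have aps: "(\<lambda>j. \<bar>a j\<bar> powr p) summable_on UNIV"
    by (rule norm_summable_imp_summable_on) (use a in simp)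
  have mp: "\<bar>m x\<bar> powr p \<le> infsum (\<lambda>j. \<bar>a j\<bar> powr p) (F x)" for x
    using abs_infsum_powr_le[OF sumF[OF as] sumF[OF aps] p] p
    by (auto simp: m_def intro!: infsum_nonneg)
  have mps: "(\<lambda>x. \<bar>m x\<bar> powr p) summable_on UNIV"
    by (rule summable_on_comparison_test[OF fib[THEN conjunct2]]) (use a(2) mp in auto)
  show ?thesis
  proof (rule that[of m])
    have "m x = 0" if "x \<notin> range q" for x
      using that by (auto simp: m_def F_def intro: infsum_0 simp: image_iff)
    then have "{x. m x \<noteq> 0} \<subseteq> range q" by blast
    then show "countable {x. m x \<noteq> 0}"
      by (rule countable_subset) auto
    show "{x. m x \<noteq> 0} \<subseteq> \<Omega>"
      by (auto simp: m_def)
    fix \<phi> :: "'b \<Rightarrow> real" and M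
    assume \<phi>: "\<And>x. \<bar>\<phi> x\<bar> \<le> M" "\<And>x. x \<notin> \<Omega> \<Longrightarrow> \<phi> x = 0"
    have "summable (\<lambda>j. \<bar>a j * \<phi> (q j)\<bar>)"
      by (rule summable_comparison_test'[OF summable_mult2[OF a(1), of M]])
         (use \<phi>(1) in \<open>auto simp: abs_mult intro!: mult_left_mono\<close>)
    from fib[OF this, THEN conjunct1]
    have "(\<Sum>\<^sub>\<infinity>x. \<Sum>\<^sub>\<infinity>j\<in>F x. a j * \<phi> (q j)) = (\<Sum>j. a j * \<phi> (q j))" .
    moreover have "(\<Sum>\<^sub>\<infinity>j\<in>F x. a j * \<phi> (q j)) = m x * \<phi> x" for x
    proof -
      have "(\<Sum>\<^sub>\<infinity>j\<in>F x. a j * \<phi> (q j)) = (\<Sum>\<^sub>\<infinity>j\<in>F x. a j * \<phi> x)"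
        by (rule infsum_cong) (auto simp: F_def)
      also have "\<dots> = infsum a (F x) * \<phi> x"
        by (rule infsum_cmult_left) (use sumF[OF as] in simp)
      also have "\<dots> = m x * \<phi> x"
        using \<phi>(2) by (simp add: m_def)
      finally show ?thesis .
    qed
    ultimately show "(\<Sum>\<^sub>\<infinity>x. m x * \<phi> x) = (\<Sum>j. a j * \<phi> (q j))"
      by simp
  next
    show "(\<Sum>\<^sub>\<infinity>x. \<bar>m x\<bar> powr p) \<le> (\<Sum>j. \<bar>a j\<bar> powr p)"
      using infsum_mono[OF mps fib[THEN conjunct2] mp] fib[of "\<lambda>j. \<bar>a j\<bar> powr p"] a(2) by simp
  next
    fix x assume "\<And>j. a j \<in> \<int>"
    then show "m x \<in> \<int>"
      using infsum_in_Ints[OF sumF[OF as]] by (simp add: m_def)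
  qed (use mps in auto)
qed

section \<open>Lattices and translations\<close>

lemma nn_integral_lborel_translate:
  fixes c :: "'a :: euclidean_space"
  assumes [measurable]: "f \<in> borel_measurable borel"
  shows "(\<integral>\<^sup>+x. f (x + c) \<partial>lborel) = (\<integral>\<^sup>+x. f x \<partial>lborel)"
proof -
  have "(\<integral>\<^sup>+x. f x \<partial>lborel) = (\<integral>\<^sup>+x. f x \<partial>distr lborel borel ((+) c))"
    by (simp add: lborel_distr_plus)
  also have "\<dots> = (\<integral>\<^sup>+x. f (c + x) \<partial>lborel)"
    by (subst nn_integral_distr) auto
  finally show ?thesis by (simp add: add.commute)
qed

definition lat :: "real \<Rightarrow> real \<Rightarrow> int \<times> int \<Rightarrow> real \<times> real" where
  "lat h1 h2 p = (of_int (fst p) * h1, of_int (snd p) * h2)"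

text \<open>Half-open, so that the lattice translates cover every point exactly once.\<close>

definition tile :: "real \<Rightarrow> real \<Rightarrow> (real \<times> real) set" where
  "tile h1 h2 = {0..<h1} \<times> {0..<h2}"

lemma tile_borel [measurable]: "tile h1 h2 \<in> sets borel"
  by (auto simp: tile_def simp flip: borel_prod)

lemma emeasure_tile:
  assumes "0 \<le> h1" "0 \<le> h2"
  shows "emeasure lborel (tile h1 h2) = ennreal (h1 * h2)"
  using assms unfolding tile_def
  by (subst lborel_prod[symmetric], subst lborel.emeasure_pair_measure_Times) (auto simp: ennreal_mult)

lemma floor_unique_lattice:
  fixes h y :: real
  assumes "h > 0"
  shows "0 \<le> y - of_int i * h \<and> y - of_int i * h < h \<longleftrightarrow> i = \<lfloor>y / h\<rfloor>"
proof
  assume "i = \<lfloor>y / h\<rfloor>"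
  then show "0 \<le> y - of_int i * h \<and> y - of_int i * h < h"
    using floor_divide_lower[OF assms, of y] floor_divide_upper[OF assms, of y] by (auto simp: algebra_simps)
qed (use assms in \<open>auto simp: field_simps intro!: floor_unique[symmetric]\<close>)

lemma mem_tile_lattice_iff:
  assumes "h1 > 0" "h2 > 0"
  shows "x - lat h1 h2 p \<in> tile h1 h2 \<longleftrightarrow> p = (\<lfloor>fst x / h1\<rfloor>, \<lfloor>snd x / h2\<rfloor>)"
  using floor_unique_lattice[OF assms(1), of "fst x" "fst p"] floor_unique_lattice[OF assms(2), of "snd x" "snd p"]
  by (cases p; cases x) (auto simp: tile_def lat_def)

text \<open>Cut the plane into tiles and translate each back to the origin; Tonelli exchanges the
  sum over tiles with the integral.\<close>

lemma nn_integral_tiling: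
  assumes h: "h1 > 0" "h2 > 0" and [measurable]: "f \<in> borel_measurable borel"
  shows "(\<integral>\<^sup>+x. f x \<partial>lborel) =
    (\<integral>\<^sup>+x. indicator (tile h1 h2) x * (\<integral>\<^sup>+p. f (x + lat h1 h2 p) \<partial>count_space UNIV) \<partial>lborel)"
proof -
  let ?T = "tile h1 h2" and ?l = "lat h1 h2"
  have "(\<integral>\<^sup>+x. indicator ?T x * (\<integral>\<^sup>+p. f (x + ?l p) \<partial>count_space UNIV) \<partial>lborel)
      = (\<integral>\<^sup>+x. (\<integral>\<^sup>+p. indicator ?T x * f (x + ?l p) \<partial>count_space UNIV) \<partial>lborel)"
    by (simp add: nn_integral_cmult)
  also have "\<dots> = (\<integral>\<^sup>+p. (\<integral>\<^sup>+x. indicator ?T x * f (x + ?l p) \<partial>lborel) \<partial>count_space UNIV)"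
    by (rule nn_integral_count_space_nn_integral) auto
  also have "\<dots> = (\<integral>\<^sup>+p. (\<integral>\<^sup>+x. indicator ?T (x - ?l p) * f x \<partial>lborel) \<partial>count_space UNIV)"
  proof (rule nn_integral_cong)
    fix p
    have "(\<lambda>x. indicator ?T (x - ?l p) * f x) \<in> borel_measurable borel"
      by measurable
    from nn_integral_lborel_translate[OF this, of "?l p"]
    show "(\<integral>\<^sup>+x. indicator ?T x * f (x + ?l p) \<partial>lborel) = (\<integral>\<^sup>+x. indicator ?T (x - ?l p) * f x \<partial>lborel)"
      by simp
  qed
  also have "\<dots> = (\<integral>\<^sup>+x. (\<integral>\<^sup>+p. indicator ?T (x - ?l p) * f x \<partial>count_space UNIV) \<partial>lborel)"
    by (rule nn_integral_count_space_nn_integral[symmetric]) auto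
  also have "\<dots> = (\<integral>\<^sup>+x. f x \<partial>lborel)"
  proof (rule nn_integral_cong)
    fix x
    have "(\<integral>\<^sup>+p. indicator ?T (x - ?l p) * f x \<partial>count_space UNIV)
       = (\<integral>\<^sup>+p. f x * indicator {(\<lfloor>fst x / h1\<rfloor>, \<lfloor>snd x / h2\<rfloor>)} p \<partial>count_space UNIV)"
      by (rule nn_integral_cong) (auto simp: indicator_def mem_tile_lattice_iff[OF h])
    then show "(\<integral>\<^sup>+p. indicator ?T (x - ?l p) * f x \<partial>count_space UNIV) = f x"
      by (simp add: nn_integral_cmult_indicator)
  qed
  finally show ?thesis ..
qed

text \<open>First-moment argument: averaged over the offsets in one tile, the lattice sum is the
  integral divided by \<open>h1 * h2\<close>, so not every offset can give \<open>c\<close> or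
  more.\<close>

lemma exists_good_lattice_offset:
  assumes h: "h1 > 0" "h2 > 0" and f: "f \<in> borel_measurable borel" and c: "0 \<le> c"
    and less: "(\<integral>\<^sup>+x. f x \<partial>lborel) < ennreal (c * (h1 * h2))"
  obtains x0 where "(\<integral>\<^sup>+p. f (x0 + lat h1 h2 p) \<partial>count_space UNIV) < ennreal c"
proof (rule ccontr)
  assume "\<not> thesis"
  then have ge: "ennreal c \<le> (\<integral>\<^sup>+p. f (x + lat h1 h2 p) \<partial>count_space UNIV)" for x
    using that by (meson not_le)
  have "ennreal (c * (h1 * h2)) = (\<integral>\<^sup>+x. indicator (tile h1 h2) x * ennreal c \<partial>lborel)"
    using h c by (subst nn_integral_multc) (auto simp: emeasure_tile ennreal_mult[symmetric] mult.commute)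
  also have "\<dots> \<le> (\<integral>\<^sup>+x. f x \<partial>lborel)"
    unfolding nn_integral_tiling[OF h f]
    by (intro nn_integral_mono mult_left_mono ge) auto
  finally show False using less by simp
qed

section \<open>Continuity of translations in L^1\<close>

definition L1_modulus :: "('a::euclidean_space \<Rightarrow> real) \<Rightarrow> 'a \<Rightarrow> ennreal" where
  "L1_modulus f t = (\<integral>\<^sup>+x. ennreal \<bar>f (x + t) - f x\<bar> \<partial>lborel)"

text \<open>The factor 2 counts the approximation error once at \<open>x\<close> and once at
  \<open>x + t\<close>; by translation invariance both have the same integral.\<close>

lemma L1_modulus_le:
  fixes f g :: "'a::euclidean_space \<Rightarrow> real"
  assumes [measurable]: "f \<in> borel_measurable borel" "g \<in> borel_measurable borel"
  shows "L1_modulus f t \<le> L1_modulus g t + 2 * (\<integral>\<^sup>+x. ennreal \<bar>f x - g x\<bar> \<partial>lborel)"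
proof -
  have "L1_modulus f t \<le> (\<integral>\<^sup>+x. (ennreal \<bar>g (x + t) - g x\<bar> + ennreal \<bar>f (x + t) - g (x + t)\<bar>) + ennreal \<bar>f x - g x\<bar> \<partial>lborel)"
    unfolding L1_modulus_def
    by (intro nn_integral_mono) (simp flip: ennreal_plus)
  also have "\<dots> = L1_modulus g t + (\<integral>\<^sup>+x. ennreal \<bar>f (x + t) - g (x + t)\<bar> \<partial>lborel) + (\<integral>\<^sup>+x. ennreal \<bar>f x - g x\<bar> \<partial>lborel)"
    unfolding L1_modulus_def by (simp add: nn_integral_add)
  also have "(\<integral>\<^sup>+x. ennreal \<bar>f (x + t) - g (x + t)\<bar> \<partial>lborel) = (\<integral>\<^sup>+x. ennreal \<bar>f x - g x\<bar> \<partial>lborel)"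
    by (rule nn_integral_lborel_translate) measurable
  finally show ?thesis by (simp add: mult_2 add.assoc)
qed

text \<open>Openness gives the pointwise limit: a point of \<open>U\<close> stays in
  \<open>U\<close> under small shifts. This handles the points that leave \<open>U\<close>; those
  that enter have the same measure, because \<open>U\<close> has finite measure.\<close>

lemma L1_modulus_indicator_open:
  fixes U :: "'a::euclidean_space set"
  assumes U: "open U" "emeasure lborel U < \<infinity>" and t: "t \<longlonglongrightarrow> 0"
  shows "(\<lambda>n. L1_modulus (indicator U) (t n)) \<longlonglongrightarrow> 0"
proof -
  have [measurable]: "U \<in> sets borel" using U by auto
  have eq: "L1_modulus (indicator U) s = 2 * (\<integral>\<^sup>+x. indicator U x * indicator (- U) (x + s) \<partial>lborel)" for s
  proof -
    \<comment> \<open>\<open>a\<close> and \<open>b\<close> measure the points leaving and entering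
      \<open>U\<close> under the shift, \<open>c\<close> those staying; finiteness of
      \<open>c\<close> lets it cancel.\<close>
    define a where "a = (\<integral>\<^sup>+x. indicator U x * indicator (- U) (x + s) \<partial>lborel)"
    define b where "b = (\<integral>\<^sup>+x. indicator (- U) x * indicator U (x + s) \<partial>lborel)"
    define c where "c = (\<integral>\<^sup>+x. indicator U x * indicator U (x + s) \<partial>lborel)"
    have "a + c = (\<integral>\<^sup>+x. indicator U x * indicator (- U) (x + s) + indicator U x * indicator U (x + s) \<partial>lborel)"
      unfolding a_def c_def by (rule nn_integral_add[symmetric]) measurable
    also have "\<dots> = (\<integral>\<^sup>+x. indicator U x \<partial>lborel)"
      by (rule nn_integral_cong) (simp split: split_indicator)
    also have "\<dots> = (\<integral>\<^sup>+x. indicator U (x + s) \<partial>lborel)"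
      by (rule nn_integral_lborel_translate[symmetric]) measurable
    also have "\<dots> = (\<integral>\<^sup>+x. indicator (- U) x * indicator U (x + s) + indicator U x * indicator U (x + s) \<partial>lborel)"
      by (rule nn_integral_cong) (simp split: split_indicator)
    also have "\<dots> = b + c"
      unfolding b_def c_def by (rule nn_integral_add) measurable
    finally have "a + c = b + c" .
    moreover have "c \<noteq> top"
    proof -
      have "c \<le> (\<integral>\<^sup>+x. indicator U x \<partial>lborel)"
        unfolding c_def by (intro nn_integral_mono) (auto simp: indicator_def)
      then show ?thesis using U(2) by (auto simp: top_unique)
    qed
    ultimately have "a = b"
      by (metis ennreal_add_diff_cancel_right)
    have "L1_modulus (indicator U) s = a + b"
      unfolding a_def b_def L1_modulus_def
      by (subst nn_integral_add[symmetric]) (measurable, rule nn_integral_cong, simp split: split_indicator)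
    then show ?thesis using \<open>a = b\<close> by (simp add: mult_2 a_def)
  qed
  have "(\<lambda>n. \<integral>\<^sup>+x. indicator U x * indicator (- U) (x + t n) \<partial>lborel) \<longlonglongrightarrow> (\<integral>\<^sup>+(x::'a). 0 \<partial>lborel)"
  proof (rule nn_integral_dominated_convergence[where w = "indicator U"])
    show "(\<integral>\<^sup>+x. indicator U x \<partial>lborel) < \<infinity>"
      using U by simp
    show "AE x in lborel. (\<lambda>n. indicator U x * indicator (- U) (x + t n) :: ennreal) \<longlonglongrightarrow> 0"
    proof (rule AE_I2)
      fix x :: 'a
      show "(\<lambda>n. indicator U x * indicator (- U) (x + t n) :: ennreal) \<longlonglongrightarrow> 0"
      proof (cases "x \<in> U")
        case True
        have "(\<lambda>n. x + t n) \<longlonglongrightarrow> x"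
          using tendsto_add[OF tendsto_const[of x] t] by simp
        then have "\<forall>\<^sub>F n in sequentially. x + t n \<in> U"
          using U True topological_tendstoD by blast
        then show ?thesis
            by (intro tendsto_eventually) (auto elim!: eventually_mono simp: indicator_def)
      qed auto
    qed
  qed (measurable, auto split: split_indicator)
  then have "(\<lambda>n. 2 * (\<integral>\<^sup>+x. indicator U x * indicator (- U) (x + t n) \<partial>lborel)) \<longlonglongrightarrow> 2 * 0"
    by (intro ennreal_tendsto_cmult) auto
  then show ?thesis by (simp add: eq)
qed

lemma L1_modulus_approx:
  fixes f :: "'a::euclidean_space \<Rightarrow> real"
  assumes f: "f \<in> borel_measurable borel"
    and approx: "\<And>e. e > 0 \<Longrightarrow> \<exists>g \<in> borel_measurable borel. (\<lambda>n. L1_modulus g (t n)) \<longlonglongrightarrow> 0 \<and>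
      (\<integral>\<^sup>+x. ennreal \<bar>f x - g x\<bar> \<partial>lborel) \<le> ennreal e"
  shows "(\<lambda>n. L1_modulus f (t n)) \<longlonglongrightarrow> 0"
proof (rule order_tendstoI)
  fix a :: ennreal assume "0 < a"
  then obtain b :: ennreal where "0 < b" "b < a" using dense by blast
  then have "b \<noteq> top" by auto
  then obtain e where e: "b = ennreal e" "e > 0"
    using \<open>0 < b\<close> by (cases b) auto
  obtain g where g: "g \<in> borel_measurable borel" "(\<lambda>n. L1_modulus g (t n)) \<longlonglongrightarrow> 0"
    "(\<integral>\<^sup>+x. ennreal \<bar>f x - g x\<bar> \<partial>lborel) \<le> ennreal (e / 3)"
    using approx[of "e / 3"] e by auto
  have "\<forall>\<^sub>F n in sequentially. L1_modulus g (t n) < ennreal (e / 3)"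
    using g(2) e by (intro order_tendstoD) auto
  then show "\<forall>\<^sub>F n in sequentially. L1_modulus f (t n) < a"
  proof eventually_elim
    case (elim n)
    have "L1_modulus f (t n) \<le> L1_modulus g (t n) + 2 * (\<integral>\<^sup>+x. ennreal \<bar>f x - g x\<bar> \<partial>lborel)"
      by (rule L1_modulus_le[OF f g(1)])
    also have "\<dots> \<le> ennreal (e / 3) + 2 * ennreal (e / 3)"
      using elim g(3) by (intro add_mono mult_left_mono) auto
    also have "\<dots> = ennreal (e / 3) + (ennreal (e / 3) + ennreal (e / 3))"
      by (simp only: mult_2)
    also have "\<dots> = ennreal (e / 3 + (e / 3 + e / 3))"
      using e by (simp only: ennreal_plus[symmetric] divide_nonneg_nonneg add_nonneg_nonneg less_imp_le zero_le_numeral)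
    also have "\<dots> = ennreal e" by simp
    also have "\<dots> < a" using \<open>b < a\<close> e by simp
    finally show ?case .
  qed
qed simp

text \<open>The property passes from open sets to Borel sets by outer regularity, and from there to
  integrable functions by linearity and L^1 limits.\<close>

lemma L1_modulus_tendsto_0:
  fixes f :: "'a::euclidean_space \<Rightarrow> real"
  assumes f: "integrable lborel f" and t: "t \<longlonglongrightarrow> 0"
  shows "(\<lambda>n. L1_modulus f (t n)) \<longlonglongrightarrow> 0"
  using f
proof (induction rule: integrable_induct)
  case (base A c)
  have A [measurable]: "A \<in> sets borel" using base by simp
  show ?case
  proof (rule L1_modulus_approx)
    fix e :: real assume e: "e > 0"
    \<comment> \<open>The added 1 covers \<open>c = 0\<close> and still gives
      \<open>|c| * d <= e\<close>.\<close>
    define d where "d = e / (\<bar>c\<bar> + 1)"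
    have d: "d > 0" using e by (simp add: d_def)
    obtain U where U: "open U" "A \<subseteq> U" "emeasure lborel (U - A) < ennreal d"
      using outer_regular_lborel[OF A d] .
    have [measurable]: "U \<in> sets borel" using U by auto
    have "emeasure lborel U = emeasure lborel (U - A) + emeasure lborel A"
      using U(2) by (subst plus_emeasure) (auto intro!: arg_cong[where f = "emeasure lborel"])
    also have "\<dots> < \<infinity>"
      using U(3) base by (simp add: less_top[symmetric]) auto
    finally have fin: "emeasure lborel U < \<infinity>" .
    show "\<exists>g \<in> borel_measurable borel. (\<lambda>n. L1_modulus g (t n)) \<longlonglongrightarrow> 0 \<and>
      (\<integral>\<^sup>+x. ennreal \<bar>indicator A x *\<^sub>R c - g x\<bar> \<partial>lborel) \<le> ennreal e"
    proof (intro bexI[of _ "\<lambda>x. indicator U x * c"] conjI)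
      have "L1_modulus (\<lambda>x. indicator U x * c) s = ennreal \<bar>c\<bar> * L1_modulus (indicator U) s" for s
        unfolding L1_modulus_def
        by (subst nn_integral_cmult[symmetric])
           (auto intro!: nn_integral_cong simp: abs_mult[symmetric] ennreal_mult[symmetric] algebra_simps)
      then show "(\<lambda>n. L1_modulus (\<lambda>x. indicator U x * c) (t n)) \<longlonglongrightarrow> 0"
        using ennreal_tendsto_cmult[OF _ L1_modulus_indicator_open[OF U(1) fin t], of "ennreal \<bar>c\<bar>"] by simp
      have "(\<integral>\<^sup>+x. ennreal \<bar>indicator A x *\<^sub>R c - indicator U x * c\<bar> \<partial>lborel)
          = (\<integral>\<^sup>+x. ennreal \<bar>c\<bar> * indicator (U - A) x \<partial>lborel)"
        using U(2) by (intro nn_integral_cong) (auto simp: indicator_def)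
      also have "\<dots> = ennreal \<bar>c\<bar> * emeasure lborel (U - A)"
        by (simp add: nn_integral_cmult_indicator)
      also have "\<dots> \<le> ennreal \<bar>c\<bar> * ennreal d"
        using U by (intro mult_left_mono) auto
      also have "\<dots> \<le> ennreal e"
        using d e by (simp add: d_def ennreal_mult[symmetric] field_simps)
      finally show "(\<integral>\<^sup>+x. ennreal \<bar>indicator A x *\<^sub>R c - indicator U x * c\<bar> \<partial>lborel) \<le> ennreal e" .
    qed measurable
  qed measurable
next
  case (add f g)
  have [measurable]: "f \<in> borel_measurable borel" "g \<in> borel_measurable borel"
    using add by auto
  have le: "L1_modulus (\<lambda>x. f x + g x) s \<le> L1_modulus f s + L1_modulus g s" for s
    unfolding L1_modulus_def
    by (subst nn_integral_add[symmetric]) (auto intro!: nn_integral_mono simp flip: ennreal_plus)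
  show ?case
    by (rule tendsto_sandwich[OF _ _ tendsto_const tendsto_add[OF add.IH, simplified]]) (use le in auto)
next
  case (lim f s)
  have [measurable]: "f \<in> borel_measurable borel" "s i \<in> borel_measurable borel" for i
    using lim.hyps by auto
  have "(\<lambda>i. \<integral>\<^sup>+x. norm (f x - s i x) \<partial>lborel) \<longlonglongrightarrow> 0"
  proof (rule nn_integral_dominated_convergence_norm[where w = "\<lambda>x. 2 * norm (f x)"])
    show "(\<integral>\<^sup>+x. ennreal (2 * norm (f x)) \<partial>lborel) < \<infinity>"
      using lim.hyps by (simp add: ennreal_mult nn_integral_cmult ennreal_mult_less_top integrable_iff_bounded)
  qed (use lim.hyps in auto)
  then have ev: "\<forall>\<^sub>F i in sequentially. (\<integral>\<^sup>+x. norm (f x - s i x) \<partial>lborel) < ennreal e" if "e > 0" for e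
    using that by (intro order_tendstoD) auto
  show ?case
  proof (rule L1_modulus_approx)
    fix e :: real assume "e > 0"
    from ev[OF this] obtain i where "(\<integral>\<^sup>+x. norm (f x - s i x) \<partial>lborel) < ennreal e"
      using eventually_happens' by (metis (no_types, lifting) sequentially_bot)
    then show "\<exists>g \<in> borel_measurable borel. (\<lambda>n. L1_modulus g (t n)) \<longlonglongrightarrow> 0 \<and>
      (\<integral>\<^sup>+x. ennreal \<bar>f x - g x\<bar> \<partial>lborel) \<le> ennreal e"
      using lim.IH by (intro bexI[of _ "s i"]) auto
  qed measurable
qed

text \<open>A tile contains uncountably many shifts, so the sequential statement is turned into one
  that is uniform over small \<open>t\<close>.\<close>

lemma L1_modulus_uniform:
  fixes f :: "'a::euclidean_space \<Rightarrow> real"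
  assumes f: "integrable lborel f" and e: "e > 0"
  obtains d where "d > 0" "\<And>t. norm t < d \<Longrightarrow> L1_modulus f t \<le> ennreal e"
proof (rule ccontr)
  note found = that
  assume neg: "\<not> thesis"
  have "\<exists>t. norm t < d \<and> \<not> L1_modulus f t \<le> ennreal e" if "d > 0" for d
    using neg \<open>d > 0\<close> found[of d] by blast
  then have "\<exists>t. norm t < inverse (real (Suc n)) \<and> \<not> L1_modulus f t \<le> ennreal e" for n
    by simp
  then obtain t where t: "\<And>n. norm (t n) < inverse (real (Suc n))" "\<And>n. \<not> L1_modulus f (t n) \<le> ennreal e"
    by metis
  have "t \<longlonglongrightarrow> 0"
    by (rule LIMSEQ_norm_0) (use t(1) in \<open>simp add: inverse_eq_divide\<close>)
  then have "(\<lambda>n. L1_modulus f (t n)) \<longlonglongrightarrow> 0"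
    by (rule L1_modulus_tendsto_0[OF f])
  then have "\<forall>\<^sub>F n in sequentially. L1_modulus f (t n) < ennreal e"
    using e by (intro order_tendstoD) auto
  then obtain n where "L1_modulus f (t n) < ennreal e"
    using eventually_happens' by (metis (no_types, lifting) sequentially_bot)
  then show False using t(2)[of n] by auto
qed

section \<open>Summation by parts\<close>

lemma pd_eq_0_outside:
  assumes K: "closed K" and f: "\<And>x. x \<notin> K \<Longrightarrow> f x = 0" and x: "x \<notin> K"
  shows "pd b f x = 0"
proof -
  obtain x1 x2 where [simp]: "x = (x1, x2)" by (cases x)
  have "open (- K)" using K by auto
  then have ev: "\<forall>\<^sub>F y in nhds x. y \<notin> K"
    using x by (auto simp: eventually_nhds intro!: exI[of _ "- K"])
  have "((\<lambda>t. (t, x2)) \<longlongrightarrow> x) (nhds x1)" "((\<lambda>t. (x1, t)) \<longlongrightarrow> x) (nhds x2)"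
    by (auto intro!: tendsto_Pair filterlim_ident)
  then have "\<forall>\<^sub>F t in nhds x1. (t, x2) \<notin> K" "\<forall>\<^sub>F t in nhds x2. (x1, t) \<notin> K"
    using ev by (auto simp: filterlim_iff)
  then have "\<forall>\<^sub>F t in nhds x1. f (t, x2) = 0" "\<forall>\<^sub>F t in nhds x2. f (x1, t) = 0"
    by (auto elim!: eventually_mono simp: f)
  then have "deriv (\<lambda>t. f (t, x2)) x1 = deriv (\<lambda>_. 0) x1" "deriv (\<lambda>t. f (x1, t)) x2 = deriv (\<lambda>_. 0) x2"
    by (blast intro: deriv_cong_ev)+
  then show ?thesis by (simp add: pd_def)
qed

lemma continuous_compact_support_bounded:
  fixes f :: "'a :: topological_space \<Rightarrow> real"
  assumes "continuous_on UNIV f" "compact K" "\<And>x. x \<notin> K \<Longrightarrow> f x = 0"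
  obtains M where "M > 0" "\<And>x. \<bar>f x\<bar> \<le> M"
proof -
  have "compact (f ` K)"
    using assms by (intro compact_continuous_image) (auto intro: continuous_on_subset)
  then obtain M where M: "M > 0" "\<And>y. y \<in> f ` K \<Longrightarrow> norm y \<le> M"
    using compact_imp_bounded bounded_pos by metis
  have "\<bar>f x\<bar> \<le> M" for x
    using M assms(3)[of x] by (cases "x \<in> K") auto
  then show ?thesis using that M by blast
qed

lemma test_fun_cases:
  assumes "test_fun \<Omega> \<phi>"
  obtains K M where "compact K" "K \<subseteq> \<Omega>" "\<And>x. x \<notin> K \<Longrightarrow> \<phi> x = 0"
    "\<And>x. x \<notin> K \<Longrightarrow> pds [True, False] \<phi> x = 0" "M > 0"
    "\<And>x. \<bar>\<phi> x\<bar> \<le> M" "\<And>x. \<bar>pds [True, False] \<phi> x\<bar> \<le> M"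
    "continuous_on UNIV \<phi>" "continuous_on UNIV (pds [True, False] \<phi>)"
proof -
  obtain K where K: "compact K" "K \<subseteq> \<Omega>" "\<And>x. x \<notin> K \<Longrightarrow> \<phi> x = 0" and sm: "smooth2 \<phi>"
    using assms by (auto simp: test_fun_def)
  have cont: "continuous_on UNIV (pds bs \<phi>)" for bs
    using sm by (auto simp: smooth2_def)
  have c: "continuous_on UNIV \<phi>" using cont[of "[]"] by simp
  have z: "pds [True, False] \<phi> x = 0" if "x \<notin> K" for x
    using K that compact_imp_closed[OF K(1)] by (auto intro!: pd_eq_0_outside)
  obtain M1 where "M1 > 0" "\<And>x. \<bar>\<phi> x\<bar> \<le> M1"
    using continuous_compact_support_bounded[OF c K(1,3)] by blast
  moreover obtain M2 where "M2 > 0" "\<And>x. \<bar>pds [True, False] \<phi> x\<bar> \<le> M2"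
    using continuous_compact_support_bounded[OF cont K(1) z] by blast
  ultimately show ?thesis
    using that[of K "max M1 M2"] K z c cont by (metis max.coboundedI1 max.coboundedI2 max.strict_coboundedI1)
qed

text \<open>The mixed second difference: the mass that the mixed derivative gives to the rectangle
  with opposite corners \<open>x\<close> and \<open>x + (h1, h2)\<close>.\<close>

definition D12 :: "real \<Rightarrow> real \<Rightarrow> (real \<times> real \<Rightarrow> real) \<Rightarrow> real \<times> real \<Rightarrow> real" where
  "D12 h1 h2 f x = f (x + (h1, h2)) - f (x + (h1, 0)) - f (x + (0, h2)) + f x"

lemma integral_atLeastLessThan_FTC:
  fixes f :: "real \<Rightarrow> real"
  assumes "a \<le> b" "\<And>x. DERIV F x :> f x" "continuous_on UNIV f"
  shows "(\<integral>x. indicator {a..<b} x * f x \<partial>lborel) = F b - F a"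
proof -
  have [measurable]: "f \<in> borel_measurable borel"
    using assms(3) by (rule borel_measurable_continuous_onI)
  have "(\<integral>x. indicator {a..<b} x * f x \<partial>lborel) = (\<integral>x. f x * indicator {a..b} x \<partial>lborel)"
    by (rule integral_cong_AE) (use AE_lborel_singleton[of b] in \<open>auto elim!: eventually_mono simp: indicator_def\<close>)
  also have "\<dots> = F b - F a"
    using assms by (intro integral_FTC_Icc_real) (auto simp: continuous_on_eq_continuous_at)
  finally show ?thesis .
qed

lemma integral_tile_pds:
  assumes sm: "smooth2 \<phi>" and int: "integrable lborel (pds [True, False] \<phi>)" and h: "h1 > 0" "h2 > 0"
  shows "(\<integral>x. indicator (tile h1 h2) (x - c) * pds [True, False] \<phi> x \<partial>lborel) = D12 h1 h2 \<phi> c"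
proof -
  obtain c1 c2 where c [simp]: "c = (c1, c2)" by (cases c)
  define g where "g = pd False \<phi>"
  define \<psi> where "\<psi> = pds [True, False] \<phi>"
  have \<psi>: "\<psi> = pd True g" by (simp add: \<psi>_def g_def)
  have sm': "continuous_on UNIV (pds bs \<phi>)"
    "(\<lambda>t. pds bs \<phi> (t, snd x)) differentiable (at (fst x))"
    "(\<lambda>t. pds bs \<phi> (fst x, t)) differentiable (at (snd x))" for bs x
    using sm by (auto simp: smooth2_def)
  have Dg: "((\<lambda>s. g (s, t)) has_real_derivative \<psi> (s, t)) (at s)" for s t
    using sm'(2)[of "[False]" "(s, t)"] unfolding \<psi> pds.simps g_def[symmetric]
    by (simp add: pd_def DERIV_deriv_iff_real_differentiable)
  have D\<phi>: "((\<lambda>t. \<phi> (s, t)) has_real_derivative g (s, t)) (at t)" for s t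
    using sm'(3)[of "[]" "(s, t)"] unfolding g_def
    by (auto simp: pd_def DERIV_deriv_iff_real_differentiable)
  have contg: "continuous_on UNIV g" and cont\<psi>: "continuous_on UNIV \<psi>"
    using sm'(1)[of "[False]"] sm'(1)[of "[True, False]"] by (simp_all add: g_def \<psi>_def)
  have c\<psi>: "continuous_on UNIV (\<lambda>s. \<psi> (s, t))" for t
    by (rule continuous_on_compose2[OF cont\<psi>]) (auto intro!: continuous_intros)
  have cg: "continuous_on UNIV (\<lambda>t. g (s, t))" for s
    by (rule continuous_on_compose2[OF contg]) (auto intro!: continuous_intros)
  let ?f = "\<lambda>s t. indicator {c1..<c1+h1} s * (indicator {c2..<c2+h2} t * \<psi> (s, t))"
  have eq: "(\<lambda>x. indicator (tile h1 h2) (x - c) * \<psi> x) = case_prod ?f"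
    "(\<lambda>x. indicator ((\<lambda>x. x - c) -` tile h1 h2) x *\<^sub>R \<psi> x) = case_prod ?f"
    by (rule ext; auto simp: tile_def indicator_def)+
  have "integrable lborel (\<lambda>x. indicator ((\<lambda>x. x - c) -` tile h1 h2) x *\<^sub>R \<psi> x)"
  proof (rule integrable_mult_indicator)
    have "(\<lambda>x. x - c) -` tile h1 h2 \<inter> space borel \<in> sets borel"
      by (rule measurable_sets[of _ borel borel]) auto
    then show "(\<lambda>x. x - c) -` tile h1 h2 \<in> sets lborel" by simp
    show "integrable lborel \<psi>" using int by (simp add: \<psi>_def)
  qed
  then have int2: "integrable (lborel \<Otimes>\<^sub>M lborel) (case_prod ?f)"
    by (simp only: eq lborel_prod)
  \<comment> \<open>\<open>pds [True, False]\<close> differentiates in the second variable first;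
    integrating first in the first variable therefore removes the outer derivative and leaves
    \<open>g\<close>.\<close>
  have "(\<integral>x. indicator (tile h1 h2) (x - c) * \<psi> x \<partial>lborel) = (\<integral>t. (\<integral>s. ?f s t \<partial>lborel) \<partial>lborel)"
    unfolding lborel_pair.integral_snd[OF int2] by (simp only: eq lborel_prod)
  also have "\<dots> = (\<integral>t. indicator {c2..<c2+h2} t * (g (c1 + h1, t) - g (c1, t)) \<partial>lborel)"
  proof (rule Bochner_Integration.integral_cong[OF refl])
    fix t
    have "(\<integral>s. ?f s t \<partial>lborel) = (\<integral>s. indicator {c2..<c2+h2} t * (indicator {c1..<c1+h1} s * \<psi> (s, t)) \<partial>lborel)"
      by (rule Bochner_Integration.integral_cong) (auto simp: mult_ac)
    also have "\<dots> = indicator {c2..<c2+h2} t * (\<integral>s. indicator {c1..<c1+h1} s * \<psi> (s, t) \<partial>lborel)"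
      by simp
    also have "(\<integral>s. indicator {c1..<c1+h1} s * \<psi> (s, t) \<partial>lborel) = g (c1 + h1, t) - g (c1, t)"
      using h by (intro integral_atLeastLessThan_FTC[OF _ Dg c\<psi>]) auto
    finally show "(\<integral>s. ?f s t \<partial>lborel) = indicator {c2..<c2+h2} t * (g (c1 + h1, t) - g (c1, t))" .
  qed
  also have "\<dots> = (\<phi> (c1 + h1, c2 + h2) - \<phi> (c1, c2 + h2)) - (\<phi> (c1 + h1, c2) - \<phi> (c1, c2))"
    using h by (intro integral_atLeastLessThan_FTC[where F = "\<lambda>t. \<phi> (c1 + h1, t) - \<phi> (c1, t)"])
       (auto intro!: DERIV_diff D\<phi> continuous_on_diff cg)
  finally show ?thesis
    by (simp add: \<psi>_def D12_def)
qed

text \<open>Both sums equal the sum over the union of \<open>I\<close> and its translate, since the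
  extra terms vanish.\<close>

lemma sum_shift_support:
  fixes f :: "'a :: ab_group_add \<Rightarrow> real"
  assumes "finite I" "\<And>p. p \<notin> I \<Longrightarrow> f p = 0" "\<And>p. p \<notin> I \<Longrightarrow> f (p + e) = 0"
  shows "(\<Sum>p\<in>I. f (p + e)) = (\<Sum>p\<in>I. f p)"
proof -
  have "(\<Sum>p\<in>I. f (p + e)) = sum f ((\<lambda>p. p + e) ` I)"
    by (subst sum.reindex) (auto intro!: inj_onI)
  also have "\<dots> = sum f (I \<union> (\<lambda>p. p + e) ` I)"
    using assms(1,3) by (intro sum.mono_neutral_left) (auto, metis diff_add_cancel imageI)
  also have "\<dots> = sum f I"
    using assms(1,2) by (intro sum.mono_neutral_right) auto
  finally show ?thesis .
qed

lemma lat_shift: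
  "lat h1 h2 (p + (1, 1)) = lat h1 h2 p + (h1, h2)"
  "lat h1 h2 (p + (1, 0)) = lat h1 h2 p + (h1, 0)"
  "lat h1 h2 (p + (0, 1)) = lat h1 h2 p + (0, h2)"
  by (simp_all add: lat_def prod_eq_iff distrib_right)

text \<open>Shifting the index in three of the four terms moves the differences from \<phi> to
  \<open>U\<close>; the signs of the two directions cancel, and \<phi> is read at the opposite
  corner of the cell. There are no boundary terms because \<open>U\<close> vanishes at all corners
  of the cells outside \<open>I\<close>.\<close>

lemma summation_by_parts_lattice:
  fixes U \<phi> :: "real \<times> real \<Rightarrow> real" and x0 :: "real \<times> real" and h1 h2 :: real
  defines "X \<equiv> \<lambda>p. x0 + lat h1 h2 p"
  assumes I: "finite I"
    and 0: "\<And>p. p \<notin> I \<Longrightarrow> U (X p) = 0" "\<And>p. p \<notin> I \<Longrightarrow> U (X p + (h1, 0)) = 0"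
      "\<And>p. p \<notin> I \<Longrightarrow> U (X p + (0, h2)) = 0" "\<And>p. p \<notin> I \<Longrightarrow> U (X p + (h1, h2)) = 0"
  shows "(\<Sum>p\<in>I. U (X p) * D12 h1 h2 \<phi> (X p)) = (\<Sum>p\<in>I. D12 h1 h2 U (X p) * \<phi> (X p + (h1, h2)))"
proof -
  have X: "X (p + (1, 1)) = X p + (h1, h2)" "X (p + (1, 0)) = X p + (h1, 0)" "X (p + (0, 1)) = X p + (0, h2)" for p
    by (simp_all add: X_def lat_shift add.assoc)
  have a: "(h1, 0) + (0, h2) = (h1, h2)" "(0, h2) + (h1, 0) = (h1, h2)" by auto
  have s1: "(\<Sum>p\<in>I. U (X p + (h1, h2)) * \<phi> (X p + (h1, h2))) = (\<Sum>p\<in>I. U (X p) * \<phi> (X p))"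
    using sum_shift_support[OF I, of "\<lambda>p. U (X p) * \<phi> (X p)" "(1, 1)"] 0 by (simp add: X)
  have s2: "(\<Sum>p\<in>I. U (X p + (h1, 0)) * \<phi> (X p + (h1, h2))) = (\<Sum>p\<in>I. U (X p) * \<phi> (X p + (0, h2)))"
    using sum_shift_support[OF I, of "\<lambda>p. U (X p) * \<phi> (X p + (0, h2))" "(1, 0)"] 0 by (simp add: X add.assoc a)
  have s3: "(\<Sum>p\<in>I. U (X p + (0, h2)) * \<phi> (X p + (h1, h2))) = (\<Sum>p\<in>I. U (X p) * \<phi> (X p + (h1, 0)))"
    using sum_shift_support[OF I, of "\<lambda>p. U (X p) * \<phi> (X p + (h1, 0))" "(0, 1)"] 0 by (simp add: X add.assoc a)
  show ?thesis
    unfolding D12_def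
    by (simp add: algebra_simps sum.distrib sum_subtractf) (use s1 s2 s3 in \<open>simp add: algebra_simps\<close>)
qed

section \<open>The error of sampling at lattice points\<close>

definition osc :: "real \<Rightarrow> real \<Rightarrow> (real \<times> real \<Rightarrow> real) \<Rightarrow> real \<times> real \<Rightarrow> ennreal" where
  "osc h1 h2 U x = (\<integral>\<^sup>+t. indicator (tile h1 h2) t * ennreal \<bar>U (x + t) - U x\<bar> \<partial>lborel)"

lemma osc_measurable [measurable]:
  assumes [measurable]: "U \<in> borel_measurable borel"
  shows "osc h1 h2 U \<in> borel_measurable borel"
proof -
  have "case_prod (\<lambda>x t. indicator (tile h1 h2) t * ennreal \<bar>U (x + t) - U x\<bar>) \<in> borel_measurable (borel \<Otimes>\<^sub>M lborel)"
    by measurable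
  then show ?thesis
    unfolding osc_def by (rule lborel.borel_measurable_nn_integral)
qed

text \<open>By Tonelli, the oscillation integrated over base points is the integral of the
  translation modulus over the tile.\<close>

lemma nn_integral_osc_le:
  assumes U [measurable]: "U \<in> borel_measurable borel" and h: "h1 > 0" "h2 > 0"
    and e: "e \<ge> 0" "\<And>t. t \<in> tile h1 h2 \<Longrightarrow> L1_modulus U t \<le> ennreal e"
  shows "(\<integral>\<^sup>+x. osc h1 h2 U x \<partial>lborel) \<le> ennreal (e * (h1 * h2))"
proof -
  have "(\<integral>\<^sup>+x. osc h1 h2 U x \<partial>lborel) =
      (\<integral>\<^sup>+t. (\<integral>\<^sup>+x. indicator (tile h1 h2) t * ennreal \<bar>U (x + t) - U x\<bar> \<partial>lborel) \<partial>lborel)"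
    unfolding osc_def by (rule lborel_pair.Fubini'[symmetric]) measurable
  also have "\<dots> = (\<integral>\<^sup>+t. indicator (tile h1 h2) t * L1_modulus U t \<partial>lborel)"
    unfolding L1_modulus_def by (intro nn_integral_cong nn_integral_cmult) measurable
  also have "\<dots> \<le> (\<integral>\<^sup>+t. ennreal e * indicator (tile h1 h2) t \<partial>lborel)"
    by (intro nn_integral_mono) (auto simp: indicator_def e)
  also have "\<dots> = ennreal e * emeasure lborel (tile h1 h2)"
    by (rule nn_integral_cmult_indicator) simp
  also have "\<dots> = ennreal (e * (h1 * h2))"
    using h e(1) by (simp add: emeasure_tile ennreal_mult)
  finally show ?thesis .
qed

text \<open>On each cell the integral of \<psi> is exactly the mixed difference of \<phi>, so the
  only error comes from replacing \<open>U\<close> by its value at the corner of the cell, and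
  \<open>osc\<close> measures that.\<close>

lemma lattice_quadrature_error:
  fixes U \<phi> :: "real \<times> real \<Rightarrow> real" and x0 :: "real \<times> real" and h1 h2 :: real
  defines "X \<equiv> \<lambda>p. x0 + lat h1 h2 p" and "\<psi> \<equiv> pds [True, False] \<phi>"
  assumes sm: "smooth2 \<phi>" and \<psi>: "integrable lborel \<psi>" "M > 0" "\<And>x. \<bar>\<psi> x\<bar> \<le> M"
    and U: "integrable lborel U" and h: "h1 > 0" "h2 > 0"
    and I: "finite I" "\<And>p x. p \<notin> I \<Longrightarrow> x - X p \<in> tile h1 h2 \<Longrightarrow> U x = 0"
  shows "ennreal \<bar>(\<integral>x. U x * \<psi> x \<partial>lborel) - (\<Sum>p\<in>I. U (X p) * D12 h1 h2 \<phi> (X p))\<bar>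
    \<le> ennreal M * (\<integral>\<^sup>+p. osc h1 h2 U (X p) \<partial>count_space UNIV)"
proof -
  have [measurable]: "U \<in> borel_measurable borel" "\<psi> \<in> borel_measurable borel"
    using U \<psi>(1) by auto
  define c where "c p = (\<lambda>x. indicator (tile h1 h2) (x - X p) :: real)" for p
  have [measurable]: "c p \<in> borel_measurable borel" for p
    unfolding c_def by measurable
  have U\<psi>: "integrable lborel (\<lambda>x. U x * \<psi> x)"
    by (rule Bochner_Integration.integrable_bound[OF integrable_mult_left[OF U, of M]])
       (use \<psi> in \<open>auto simp: abs_mult intro!: mult_left_mono AE_I2\<close>)
  have int_c: "integrable lborel (\<lambda>x. c p x * f x)" if "integrable lborel f" for f :: "real \<times> real \<Rightarrow> real" and p
    by (rule Bochner_Integration.integrable_bound[OF that])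
       (use that in \<open>auto simp: c_def indicator_def\<close>)
  \<comment> \<open>The cells are disjoint, and a point whose cell lies outside \<open>I\<close>
    contributes nothing because \<open>U\<close> vanishes there.\<close>
  have part: "U x * \<psi> x = (\<Sum>p\<in>I. c p x * (U x * \<psi> x))" for x
  proof -
    define q where "q = (\<lfloor>fst (x - x0) / h1\<rfloor>, \<lfloor>snd (x - x0) / h2\<rfloor>)"
    have q: "x - X p \<in> tile h1 h2 \<longleftrightarrow> p = q" for p
      using mem_tile_lattice_iff[OF h, of "x - x0" p] by (simp add: X_def q_def algebra_simps)
    have "(\<Sum>p\<in>I. c p x * (U x * \<psi> x)) = (\<Sum>p\<in>I. if p = q then U x * \<psi> x else 0)"
      by (rule sum.cong) (auto simp: c_def q)
    also have "\<dots> = (if q \<in> I then U x * \<psi> x else 0)"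
      using I(1) by simp
    also have "\<dots> = U x * \<psi> x"
      using I(2)[of q x] q[of q] by auto
    finally show ?thesis ..
  qed
  have "(\<integral>x. U x * \<psi> x \<partial>lborel) = (\<Sum>p\<in>I. \<integral>x. c p x * (U x * \<psi> x) \<partial>lborel)"
    by (subst part, rule Bochner_Integration.integral_sum) (rule int_c[OF U\<psi>])
  also have "\<dots> - (\<Sum>p\<in>I. U (X p) * D12 h1 h2 \<phi> (X p))
      = (\<Sum>p\<in>I. \<integral>x. c p x * ((U x - U (X p)) * \<psi> x) \<partial>lborel)"
    unfolding sum_subtractf[symmetric]
  proof (rule sum.cong[OF refl])
    fix p
    have "U (X p) * D12 h1 h2 \<phi> (X p) = U (X p) * (\<integral>x. c p x * \<psi> x \<partial>lborel)"
      using integral_tile_pds[OF sm _ h, of "X p"] \<psi>(1) by (simp add: c_def \<psi>_def)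
    also have "\<dots> = (\<integral>x. c p x * (U (X p) * \<psi> x) \<partial>lborel)"
      by (subst integral_mult_right_zero[symmetric]) (simp add: mult_ac)
    finally have "(\<integral>x. c p x * (U x * \<psi> x) \<partial>lborel) - U (X p) * D12 h1 h2 \<phi> (X p)
      = (\<integral>x. c p x * (U x * \<psi> x) - c p x * (U (X p) * \<psi> x) \<partial>lborel)"
      by (simp only: Bochner_Integration.integral_diff[OF int_c[OF U\<psi>] int_c[OF integrable_mult_right[OF \<psi>(1)]]])
    then show "(\<integral>x. c p x * (U x * \<psi> x) \<partial>lborel) - U (X p) * D12 h1 h2 \<phi> (X p)
      = (\<integral>x. c p x * ((U x - U (X p)) * \<psi> x) \<partial>lborel)"
      by (simp only: right_diff_distrib[symmetric] left_diff_distrib[symmetric])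
  qed
  finally have eq: "(\<integral>x. U x * \<psi> x \<partial>lborel) - (\<Sum>p\<in>I. U (X p) * D12 h1 h2 \<phi> (X p))
      = (\<Sum>p\<in>I. \<integral>x. c p x * ((U x - U (X p)) * \<psi> x) \<partial>lborel)" .
  have cell: "ennreal \<bar>\<integral>x. c p x * ((U x - U (X p)) * \<psi> x) \<partial>lborel\<bar> \<le> ennreal M * osc h1 h2 U (X p)" for p
  proof -
    have int: "integrable lborel (\<lambda>x. c p x * ((U x - U (X p)) * \<psi> x))"
      unfolding left_diff_distrib by (intro int_c Bochner_Integration.integrable_diff U\<psi> integrable_mult_right \<psi>(1))
    have "ennreal \<bar>\<integral>x. c p x * ((U x - U (X p)) * \<psi> x) \<partial>lborel\<bar>
        \<le> (\<integral>\<^sup>+x. ennreal \<bar>c p x * ((U x - U (X p)) * \<psi> x)\<bar> \<partial>lborel)"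
      using integral_norm_bound_ennreal[OF int] by simp
    also have "\<dots> \<le> (\<integral>\<^sup>+x. ennreal M * (indicator (tile h1 h2) (x - X p) * ennreal \<bar>U x - U (X p)\<bar>) \<partial>lborel)"
    proof (rule nn_integral_mono)
      fix x
      have "\<bar>U x - U (X p)\<bar> * \<bar>\<psi> x\<bar> \<le> M * \<bar>U x - U (X p)\<bar>"
        using mult_left_mono[OF \<psi>(3)[of x], of "\<bar>U x - U (X p)\<bar>"] by (simp add: mult.commute)
      then show "ennreal \<bar>c p x * ((U x - U (X p)) * \<psi> x)\<bar>
          \<le> ennreal M * (indicator (tile h1 h2) (x - X p) * ennreal \<bar>U x - U (X p)\<bar>)"
        using \<psi>(2) by (auto simp: c_def indicator_def abs_mult ennreal_mult[symmetric])
    qed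
    also have "\<dots> = ennreal M * (\<integral>\<^sup>+x. indicator (tile h1 h2) (x - X p) * ennreal \<bar>U x - U (X p)\<bar> \<partial>lborel)"
      by (rule nn_integral_cmult) measurable
    also have "(\<integral>\<^sup>+x. indicator (tile h1 h2) (x - X p) * ennreal \<bar>U x - U (X p)\<bar> \<partial>lborel) = osc h1 h2 U (X p)"
      unfolding osc_def
      by (subst nn_integral_lborel_translate[symmetric, of _ "X p"]) (auto simp: add.commute)
    finally show ?thesis .
  qed
  have "ennreal \<bar>(\<integral>x. U x * \<psi> x \<partial>lborel) - (\<Sum>p\<in>I. U (X p) * D12 h1 h2 \<phi> (X p))\<bar>
      \<le> ennreal (\<Sum>p\<in>I. \<bar>\<integral>x. c p x * ((U x - U (X p)) * \<psi> x) \<partial>lborel\<bar>)"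
    unfolding eq by (intro ennreal_leI sum_abs)
  also have "\<dots> = (\<Sum>p\<in>I. ennreal \<bar>\<integral>x. c p x * ((U x - U (X p)) * \<psi> x) \<partial>lborel\<bar>)"
    by (rule sum_ennreal[symmetric]) auto
  also have "\<dots> \<le> (\<Sum>p\<in>I. ennreal M * osc h1 h2 U (X p))"
    by (intro sum_mono cell)
  also have "\<dots> = ennreal M * (\<Sum>p\<in>I. osc h1 h2 U (X p))"
    by (simp add: sum_distrib_left)
  also have "(\<Sum>p\<in>I. osc h1 h2 U (X p)) = (\<integral>\<^sup>+p. osc h1 h2 U (X p) \<partial>count_space I)"
    using I(1) by (simp add: nn_integral_count_space_finite)
  also have "\<dots> \<le> (\<integral>\<^sup>+p. osc h1 h2 U (X p) \<partial>count_space UNIV)"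
    by (subst nn_integral_count_space_indicator) (auto intro!: nn_integral_mono split: split_indicator)
  finally show ?thesis
    by (simp add: mult_left_mono)
qed

lemma finite_lattice_cells:
  assumes h: "h1 > 0" "h2 > 0" and \<Omega>: "bounded \<Omega>"
  shows "finite {p. \<exists>s\<in>{0..h1}. \<exists>t\<in>{0..h2}. x0 + lat h1 h2 p + (s, t) \<in> \<Omega>}"
proof -
  obtain B where B: "\<And>x. x \<in> \<Omega> \<Longrightarrow> norm x \<le> B"
    using \<Omega> by (auto simp: bounded_iff)
  have fin: "finite {i :: int. \<exists>s\<in>{0..h}. \<bar>a + of_int i * h + s\<bar> \<le> B}" if "h > 0" for a h :: real
  proof -
    define R where "R = (B + \<bar>a\<bar> + h) / h"
    have "i \<in> {-\<lceil>R\<rceil>..\<lceil>R\<rceil>}" if "s \<in> {0..h}" "\<bar>a + of_int i * h + s\<bar> \<le> B" for s and i :: int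
    proof -
      have "\<bar>of_int i * h\<bar> \<le> B + \<bar>a\<bar> + h"
        using that by auto
      then have "\<bar>of_int i\<bar> \<le> R"
        using \<open>h > 0\<close> by (simp add: R_def abs_mult field_simps)
      then have "\<bar>real_of_int i\<bar> \<le> of_int \<lceil>R\<rceil>"
        using le_of_int_ceiling order_trans by blast
      then show ?thesis by auto
    qed
    then have "{i :: int. \<exists>s\<in>{0..h}. \<bar>a + of_int i * h + s\<bar> \<le> B} \<subseteq> {-\<lceil>R\<rceil>..\<lceil>R\<rceil>}"
      by blast
    then show ?thesis using finite_subset by blast
  qed
  show ?thesis
  proof (rule finite_subset)
    show "finite ({i :: int. \<exists>s\<in>{0..h1}. \<bar>fst x0 + of_int i * h1 + s\<bar> \<le> B} \<times>
                  {i :: int. \<exists>s\<in>{0..h2}. \<bar>snd x0 + of_int i * h2 + s\<bar> \<le> B})"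
      using fin h by blast
    have "\<bar>fst y\<bar> \<le> norm y" "\<bar>snd y\<bar> \<le> norm y" for y :: "real \<times> real"
      using norm_fst_le[of "fst y" "snd y"] norm_snd_le[of "snd y" "fst y"] by auto
    then have B': "\<bar>fst y\<bar> \<le> B" "\<bar>snd y\<bar> \<le> B" if "y \<in> \<Omega>" for y
      using B[OF that] order_trans by blast+
    show "{p. \<exists>s\<in>{0..h1}. \<exists>t\<in>{0..h2}. x0 + lat h1 h2 p + (s, t) \<in> \<Omega>} \<subseteq>
      {i :: int. \<exists>s\<in>{0..h1}. \<bar>fst x0 + of_int i * h1 + s\<bar> \<le> B} \<times>
                  {i :: int. \<exists>s\<in>{0..h2}. \<bar>snd x0 + of_int i * h2 + s\<bar> \<le> B}"
    proof
      fix p assume "p \<in> {p. \<exists>s\<in>{0..h1}. \<exists>t\<in>{0..h2}. x0 + lat h1 h2 p + (s, t) \<in> \<Omega>}"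
      then obtain s t where st: "s \<in> {0..h1}" "t \<in> {0..h2}" "x0 + lat h1 h2 p + (s, t) \<in> \<Omega>"
        by blast
      have "\<bar>fst x0 + of_int (fst p) * h1 + s\<bar> \<le> B" "\<bar>snd x0 + of_int (snd p) * h2 + t\<bar> \<le> B"
        using B'[OF st(3)] by (simp_all add: lat_def)
      then show "p \<in> {i :: int. \<exists>s\<in>{0..h1}. \<bar>fst x0 + of_int i * h1 + s\<bar> \<le> B} \<times>
                  {i :: int. \<exists>s\<in>{0..h2}. \<bar>snd x0 + of_int i * h2 + s\<bar> \<le> B}"
        using st by (cases p) auto
    qed
  qed
qed

section \<open>The energy\<close>

text \<open>Used with factors of modulus 1 for reflecting the increments, and with both factors
  \<epsilon> for rescaling \<rho>.\<close>

lemma nn_integral_lborel_diag_scale: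
  fixes f :: "real \<times> real \<Rightarrow> ennreal"
  assumes [measurable]: "f \<in> borel_measurable borel" and c: "c1 \<noteq> 0" "c2 \<noteq> 0"
  shows "(\<integral>\<^sup>+z. f z \<partial>lborel) = ennreal \<bar>c1 * c2\<bar> * (\<integral>\<^sup>+z. f (c1 * fst z, c2 * snd z) \<partial>lborel)"
proof -
  have f' [measurable]: "f \<in> borel_measurable (borel \<Otimes>\<^sub>M borel)"
    by (simp add: borel_prod)
  have prod: "(\<integral>\<^sup>+z. g z \<partial>lborel) = (\<integral>\<^sup>+x. \<integral>\<^sup>+y. g (x, y) \<partial>lborel \<partial>lborel)"
    if "g \<in> borel_measurable (borel \<Otimes>\<^sub>M borel)" for g :: "real \<times> real \<Rightarrow> ennreal"
    using that by (subst lborel_prod[symmetric]) (simp add: lborel.nn_integral_fst)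
  have "(\<integral>\<^sup>+z. f z \<partial>lborel) = (\<integral>\<^sup>+x. \<integral>\<^sup>+y. f (x, y) \<partial>lborel \<partial>lborel)"
    by (rule prod) measurable
  also have "\<dots> = ennreal \<bar>c1\<bar> * (\<integral>\<^sup>+x. \<integral>\<^sup>+y. f (c1 * x, y) \<partial>lborel \<partial>lborel)"
    by (subst nn_integral_real_affine[OF _ c(1), of _ 0]) auto
  also have "(\<integral>\<^sup>+x. \<integral>\<^sup>+y. f (c1 * x, y) \<partial>lborel \<partial>lborel)
      = (\<integral>\<^sup>+x. ennreal \<bar>c2\<bar> * (\<integral>\<^sup>+y. f (c1 * x, c2 * y) \<partial>lborel) \<partial>lborel)"
    by (intro nn_integral_cong, subst nn_integral_real_affine[OF _ c(2), of _ 0]) auto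
  also have "\<dots> = ennreal \<bar>c2\<bar> * (\<integral>\<^sup>+x. \<integral>\<^sup>+y. f (c1 * x, c2 * y) \<partial>lborel \<partial>lborel)"
    by (rule nn_integral_cmult) measurable
  also have "(\<integral>\<^sup>+x. \<integral>\<^sup>+y. f (c1 * x, c2 * y) \<partial>lborel \<partial>lborel) = (\<integral>\<^sup>+z. f (c1 * fst z, c2 * snd z) \<partial>lborel)"
  proof (subst prod)
    have "(\<lambda>z. (c1 * fst z, c2 * snd z)) \<in> borel_measurable (borel :: (real \<times> real) measure)"
      by (intro borel_measurable_continuous_onI continuous_intros)
    from measurable_compose[OF this assms(1)]
    have "(\<lambda>z. f (c1 * fst z, c2 * snd z)) \<in> borel_measurable borel" .
    then show "(\<lambda>z. f (c1 * fst z, c2 * snd z)) \<in> borel_measurable (borel \<Otimes>\<^sub>M borel)"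
      by (simp add: borel_prod)
  qed simp
  finally show ?thesis
    by (simp add: abs_mult ennreal_mult mult.assoc)
qed

text \<open>The longest horizontal and the longest vertical side of a rectangle always share a corner.\<close>

lemma corner_inequality:
  fixes a b h0 h1 v0 v1 :: real
  assumes ab: "a > 0" "b > 0" "a + b \<le> 1" and d: "h1 - h0 = d" "v1 - v0 = d"
  shows "\<bar>d\<bar> powr (a + b) \<le> 2 * (\<bar>h0\<bar> powr a * \<bar>v0\<bar> powr b + \<bar>h0\<bar> powr a * \<bar>v1\<bar> powr b
    + \<bar>h1\<bar> powr a * \<bar>v0\<bar> powr b + \<bar>h1\<bar> powr a * \<bar>v1\<bar> powr b)"
proof -
  \<comment> \<open>Parallel sides have increments differing by \<open>d\<close>, so in each
    direction one of them has at least half the modulus of \<open>d\<close>; the right-hand side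
    contains every pairing of a horizontal with a vertical side.\<close>
  have h: "\<bar>d\<bar> / 2 \<le> \<bar>h0\<bar> \<or> \<bar>d\<bar> / 2 \<le> \<bar>h1\<bar>" and v: "\<bar>d\<bar> / 2 \<le> \<bar>v0\<bar> \<or> \<bar>d\<bar> / 2 \<le> \<bar>v1\<bar>"
    using d by linarith+
  have *: "(\<bar>d\<bar> / 2) powr (a + b) \<le> \<bar>x\<bar> powr a * \<bar>y\<bar> powr b"
    if "\<bar>d\<bar> / 2 \<le> \<bar>x\<bar>" "\<bar>d\<bar> / 2 \<le> \<bar>y\<bar>" for x y
    unfolding powr_add using that ab by (intro mult_mono powr_mono2) auto
  have "(\<bar>d\<bar> / 2) powr (a + b) \<le> \<bar>h0\<bar> powr a * \<bar>v0\<bar> powr b + \<bar>h0\<bar> powr a * \<bar>v1\<bar> powr b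
    + \<bar>h1\<bar> powr a * \<bar>v0\<bar> powr b + \<bar>h1\<bar> powr a * \<bar>v1\<bar> powr b" (is "_ \<le> ?R")
    using h v *[of h0 v0] *[of h0 v1] *[of h1 v0] *[of h1 v1]
    by (smt (verit) mult_nonneg_nonneg powr_ge_zero)
  then have R: "2 * (\<bar>d\<bar> / 2) powr (a + b) \<le> 2 * ?R"
    by (rule mult_left_mono) simp
  \<comment> \<open>Undoing the halving costs \<open>2 powr (a + b)\<close>, at most 2 since
    \<open>a + b <= 1\<close>.\<close>
  have "\<bar>d\<bar> powr (a + b) = 2 powr (a + b) * (\<bar>d\<bar> / 2) powr (a + b)"
    by (simp flip: powr_mult)
  also have "\<dots> \<le> 2 * (\<bar>d\<bar> / 2) powr (a + b)"
    using powr_mono[of "a + b" 1 "2 :: real"] ab by (intro mult_right_mono) auto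
  also note R
  finally show ?thesis .
qed

section \<open>The shrunken box\<close>

lemma inner_box_shift:
  assumes "x \<in> inner_box a1 b1 a2 b2 \<epsilon>" "\<bar>s\<bar> \<le> \<epsilon>" "\<bar>t\<bar> \<le> \<epsilon>"
  shows "x + (s, t) \<in> box2 a1 b1 a2 b2"
proof -
  \<comment> \<open>Otherwise \<open>y + r\<close> would be a point of the complement at distance at
    most \<epsilon> from \<open>y\<close>.\<close>
  have *: "y + r \<in> {a<..<b}" if "infdist y (- {a<..<b}) > \<epsilon>" "\<bar>r\<bar> \<le> \<epsilon>" for y r a b :: real
    using infdist_le[of "y + r" "- {a<..<b}" y] that by (auto simp: dist_real_def)
  show ?thesis
    using assms by (cases x) (auto simp: inner_box_def box2_def dest: *)
qed

lemma inner_box_subset: "0 \<le> \<epsilon> \<Longrightarrow> inner_box a1 b1 a2 b2 \<epsilon> \<subseteq> box2 a1 b1 a2 b2"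
  by (auto simp: inner_box_def box2_def)

lemma inner_box_borel [measurable]: "inner_box a1 b1 a2 b2 \<epsilon> \<in> sets borel"
proof -
  have "{s. s \<in> {a<..<b} \<and> infdist s (- {a<..<b}) > \<epsilon>} \<in> sets borel" for a b :: real
  proof -
    have [measurable]: "(\<lambda>s. infdist s (- {a<..<b})) \<in> borel_measurable borel"
      by (intro borel_measurable_continuous_onI continuous_intros)
    show ?thesis by measurable
  qed
  then show ?thesis
    unfolding inner_box_def by (subst borel_prod[symmetric]) (rule pair_measureI)
qed

text \<open>The margin \<open>d\<close> pays for the shift and for the distance \<epsilon> to the
  boundary together. Once \<open>2 * \<epsilon> < d\<close>, moving a point of the support of a test
  function by at most \<epsilon> in each coordinate keeps it in the region that the energy
  sees.\<close>

lemma compact_in_inner_box: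
  assumes K: "compact K" "K \<subseteq> box2 a1 b1 a2 b2"
  obtains d where "d > 0" "\<And>x s t \<epsilon>. x \<in> K \<Longrightarrow> 0 \<le> \<epsilon> \<Longrightarrow> \<bar>s\<bar> + \<epsilon> < d \<Longrightarrow> \<bar>t\<bar> + \<epsilon> < d \<Longrightarrow> x + (s, t) \<in> inner_box a1 b1 a2 b2 \<epsilon>"
proof -
  have int: "infdist s (- {a<..<b}) > e" if "a + d' \<le> s" "s \<le> b - d'" "e < d'" for a b s d' e :: real
  proof -
    \<comment> \<open>The distance to the empty set is 0 by convention, so a lower bound on the
      distance presupposes a nonempty complement.\<close>
    have ne: "- {a<..<b} \<noteq> {}"
      by (metis ComplI empty_iff greaterThanLessThan_iff less_irrefl)
    have "d' \<le> infdist s (- {a<..<b})"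
      unfolding infdist_notempty[OF ne] using that
      by (intro cINF_greatest ne) (auto simp: dist_real_def)
    then show ?thesis using that by simp
  qed
  have proj: "\<exists>d>0. \<forall>s\<in>C. a + d \<le> s \<and> s \<le> b - d" if C: "compact C" "C \<subseteq> {a<..<b}" for C and a b :: real
  proof (cases "C = {}")
    case True
    then show ?thesis by (intro exI[of _ 1]) auto
  next
    case False
    obtain m where m: "m \<in> C" "\<And>s. s \<in> C \<Longrightarrow> m \<le> s"
      using compact_attains_inf[OF C(1) False] by blast
    obtain M where M: "M \<in> C" "\<And>s. s \<in> C \<Longrightarrow> s \<le> M"
      using compact_attains_sup[OF C(1) False] by blast
    have "min (m - a) (b - M) > 0" using m M C by auto
    moreover have "a + min (m - a) (b - M) \<le> s \<and> s \<le> b - min (m - a) (b - M)" if "s \<in> C" for s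
      using m(2)[OF that] M(2)[OF that] by auto
    ultimately show ?thesis by blast
  qed
  have "compact (fst ` K)" "compact (snd ` K)"
    using K(1) by (auto intro!: compact_continuous_image continuous_intros)
  moreover have "fst ` K \<subseteq> {a1<..<b1}" "snd ` K \<subseteq> {a2<..<b2}"
    using K(2) by (auto simp: box2_def)
  ultimately obtain d1 d2 where d: "d1 > 0" "d2 > 0"
    "\<And>s. s \<in> fst ` K \<Longrightarrow> a1 + d1 \<le> s \<and> s \<le> b1 - d1" "\<And>s. s \<in> snd ` K \<Longrightarrow> a2 + d2 \<le> s \<and> s \<le> b2 - d2"
    using proj by metis
  show ?thesis
  proof (rule that[of "min d1 d2"])
    fix x s t \<epsilon> assume x: "x \<in> K" and st: "0 \<le> \<epsilon>" "\<bar>s\<bar> + \<epsilon> < min d1 d2" "\<bar>t\<bar> + \<epsilon> < min d1 d2"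
    have 1: "a1 + (d1 - \<bar>s\<bar>) \<le> fst x + s" "fst x + s \<le> b1 - (d1 - \<bar>s\<bar>)" "\<epsilon> < d1 - \<bar>s\<bar>"
      using d(3)[of "fst x"] x st by (auto simp: abs_if split: if_splits)
    have 2: "a2 + (d2 - \<bar>t\<bar>) \<le> snd x + t" "snd x + t \<le> b2 - (d2 - \<bar>t\<bar>)" "\<epsilon> < d2 - \<bar>t\<bar>"
      using d(4)[of "snd x"] x st by (auto simp: abs_if split: if_splits)
    have "fst x + s \<in> {a1<..<b1}" "snd x + t \<in> {a2<..<b2}"
      using 1 2 st(1) by auto
    then show "x + (s, t) \<in> inner_box a1 b1 a2 b2 \<epsilon>"
      using int[OF 1] int[OF 2] by (cases x) (simp add: inner_box_def)
  qed (use d in auto)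
qed


section \<open>The energy at a fixed increment\<close>

definition corner_energy :: "real \<Rightarrow> real \<Rightarrow> (real \<times> real \<Rightarrow> real) \<Rightarrow> (real \<times> real) set \<Rightarrow> real \<times> real \<Rightarrow> ennreal" where
  "corner_energy \<theta>1 \<theta>2 U S z = (\<integral>\<^sup>+x. indicator S x *
     ennreal (\<bar>U (x + (fst z, 0)) - U x\<bar> powr \<theta>1 * \<bar>U (x + (0, snd z)) - U x\<bar> powr \<theta>2) \<partial>lborel)"

text \<open>The four sign choices are the views from the four corners of a rectangle, whose two
  sides leave each corner in different directions.\<close>

definition sym_energy :: "real \<Rightarrow> real \<Rightarrow> (real \<times> real \<Rightarrow> real) \<Rightarrow> (real \<times> real) set \<Rightarrow> real \<times> real \<Rightarrow> ennreal" where
  "sym_energy \<theta>1 \<theta>2 U S z =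
     corner_energy \<theta>1 \<theta>2 U S (fst z, snd z) + corner_energy \<theta>1 \<theta>2 U S (- fst z, snd z) +
     corner_energy \<theta>1 \<theta>2 U S (fst z, - snd z) + corner_energy \<theta>1 \<theta>2 U S (- fst z, - snd z)"

lemma corner_energy_measurable [measurable]:
  assumes [measurable]: "U \<in> borel_measurable borel" "S \<in> sets borel"
  shows "corner_energy \<theta>1 \<theta>2 U S \<in> borel_measurable borel"
proof -
  have [measurable]: "(\<lambda>p :: (real \<times> real) \<times> real \<times> real. snd p + (fst (fst p), 0)) \<in> borel_measurable borel"
      "(\<lambda>p :: (real \<times> real) \<times> real \<times> real. snd p + (0, snd (fst p))) \<in> borel_measurable borel"
      "(\<lambda>p :: (real \<times> real) \<times> real \<times> real. snd p) \<in> borel_measurable borel"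
    by (intro borel_measurable_continuous_onI continuous_intros)+
  have "(\<lambda>p. indicator S (snd p) * ennreal (\<bar>U (snd p + (fst (fst p), 0)) - U (snd p)\<bar> powr \<theta>1 *
      \<bar>U (snd p + (0, snd (fst p))) - U (snd p)\<bar> powr \<theta>2)) \<in> borel_measurable borel"
    by measurable
  then have "case_prod (\<lambda>z x. indicator S x * ennreal (\<bar>U (x + (fst z, 0)) - U x\<bar> powr \<theta>1 *
      \<bar>U (x + (0, snd z)) - U x\<bar> powr \<theta>2)) \<in> borel_measurable (borel \<Otimes>\<^sub>M lborel)"
    unfolding split_beta' measurable_cong_sets[OF sets_pair_measure_cong[OF refl sets_lborel] refl] borel_prod .
  then show ?thesis
    unfolding corner_energy_def by (rule lborel.borel_measurable_nn_integral)
qed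

lemma rho_eps_outside:
  assumes "\<And>z. norm z > 1 \<Longrightarrow> \<rho> z = 0" "\<epsilon> > 0" "norm z > \<epsilon>"
  shows "rho_eps \<rho> \<epsilon> z = 0"
proof -
  have "norm ((1 / \<epsilon>) *\<^sub>R z) > 1"
    using assms(2,3) by (simp add: field_simps)
  then have "\<rho> ((1 / \<epsilon>) *\<^sub>R z) = 0" by (rule assms(1))
  then show ?thesis by (simp add: rho_eps_def)
qed

text \<open>On the support of the kernel both coordinates of the increment are at most \<epsilon>,
  and a point of the inner box moved along an axis by that much stays in the box, where
  \<open>U\<close> and \<open>u\<close> agree. So a global extension may replace
  \<open>u\<close>.\<close>

lemma E_eps_eq_corner_energy:
  assumes \<rho>: "\<And>z. \<rho> z \<ge> 0" "\<And>z. norm z > 1 \<Longrightarrow> \<rho> z = 0" and \<epsilon>: "\<epsilon> > 0"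
    and U [measurable]: "U \<in> borel_measurable borel" and eq: "\<And>x. x \<in> box2 a1 b1 a2 b2 \<Longrightarrow> U x = u x"
  shows "E_eps \<theta>1 \<theta>2 \<rho> a1 b1 a2 b2 u \<epsilon> =
    (\<integral>\<^sup>+z. corner_energy \<theta>1 \<theta>2 U (inner_box a1 b1 a2 b2 \<epsilon>) z * ennreal (rho_eps \<rho> \<epsilon> z / (norm z)\<^sup>2) \<partial>lborel)"
  unfolding E_eps_def
proof (rule nn_integral_cong)
  fix z :: "real \<times> real"
  let ?S = "inner_box a1 b1 a2 b2 \<epsilon>"
  let ?G = "\<lambda>x. \<bar>U (x + (fst z, 0)) - U x\<bar> powr \<theta>1 * \<bar>U (x + (0, snd z)) - U x\<bar> powr \<theta>2"
  show "(\<integral>\<^sup>+x. indicator ?S x * ennreal (\<bar>Du u x (fst z, 0)\<bar> powr \<theta>1 * \<bar>Du u x (0, snd z)\<bar> powr \<theta>2 / (norm z)\<^sup>2) \<partial>lborel)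
       * ennreal (rho_eps \<rho> \<epsilon> z) = corner_energy \<theta>1 \<theta>2 U ?S z * ennreal (rho_eps \<rho> \<epsilon> z / (norm z)\<^sup>2)"
  proof (cases "norm z > \<epsilon>")
    case True
    then show ?thesis using rho_eps_outside[OF \<rho>(2) \<epsilon> True] by simp
  next
    case False
    have z: "\<bar>fst z\<bar> \<le> \<epsilon>" "\<bar>snd z\<bar> \<le> \<epsilon>"
      using False norm_fst_le[of "fst z" "snd z"] norm_snd_le[of "snd z" "fst z"] by auto
    have "(\<integral>\<^sup>+x. indicator ?S x * ennreal (\<bar>Du u x (fst z, 0)\<bar> powr \<theta>1 * \<bar>Du u x (0, snd z)\<bar> powr \<theta>2 / (norm z)\<^sup>2) \<partial>lborel)
       = (\<integral>\<^sup>+x. (indicator ?S x * ennreal (?G x)) * ennreal (1 / (norm z)\<^sup>2) \<partial>lborel)"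
    proof (rule nn_integral_cong)
      fix x
      show "indicator ?S x * ennreal (\<bar>Du u x (fst z, 0)\<bar> powr \<theta>1 * \<bar>Du u x (0, snd z)\<bar> powr \<theta>2 / (norm z)\<^sup>2)
        = (indicator ?S x * ennreal (?G x)) * ennreal (1 / (norm z)\<^sup>2)"
      proof (cases "x \<in> ?S")
        case True
        have "x \<in> box2 a1 b1 a2 b2" "x + (fst z, 0) \<in> box2 a1 b1 a2 b2" "x + (0, snd z) \<in> box2 a1 b1 a2 b2"
          using inner_box_shift[OF True, of 0 0] inner_box_shift[OF True] z \<epsilon> by (auto simp flip: zero_prod_def)
        then have "Du u x (fst z, 0) = U (x + (fst z, 0)) - U x" "Du u x (0, snd z) = U (x + (0, snd z)) - U x"
          by (simp_all add: Du_def eq)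
        then show ?thesis
          using True by (simp, subst ennreal_mult[symmetric]) auto
      qed simp
    qed
    also have "\<dots> = (\<integral>\<^sup>+x. (indicator ?S x * ennreal (?G x)) \<partial>lborel) * ennreal (1 / (norm z)\<^sup>2)"
      by (rule nn_integral_multc) measurable
    finally have "(\<integral>\<^sup>+x. indicator ?S x * ennreal (\<bar>Du u x (fst z, 0)\<bar> powr \<theta>1 * \<bar>Du u x (0, snd z)\<bar> powr \<theta>2 / (norm z)\<^sup>2) \<partial>lborel)
       = corner_energy \<theta>1 \<theta>2 U ?S z * ennreal (1 / (norm z)\<^sup>2)"
      by (simp add: corner_energy_def)
    moreover have "rho_eps \<rho> \<epsilon> z \<ge> 0"
      using \<rho> by (simp add: rho_eps_def)
    then have "ennreal (rho_eps \<rho> \<epsilon> z / (norm z)\<^sup>2) = ennreal (1 / (norm z)\<^sup>2) * ennreal (rho_eps \<rho> \<epsilon> z)"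
      by (subst ennreal_mult[symmetric]) auto
    ultimately show ?thesis
      by (simp add: mult.assoc)
  qed
qed

text \<open>Lebesgue measure and radial weights are invariant under reflections in the axes, so the
  four views have equal integrals.\<close>

lemma nn_integral_sym_energy:
  assumes [measurable]: "U \<in> borel_measurable borel" "S \<in> sets borel" "\<omega> \<in> borel_measurable borel"
    and rad: "\<And>z w. norm z = norm w \<Longrightarrow> \<omega> z = \<omega> w"
  shows "(\<integral>\<^sup>+z. sym_energy \<theta>1 \<theta>2 U S z * \<omega> z \<partial>lborel) =
     4 * (\<integral>\<^sup>+z. corner_energy \<theta>1 \<theta>2 U S z * \<omega> z \<partial>lborel)"
proof -
  let ?c = "corner_energy \<theta>1 \<theta>2 U S" and ?I = "\<integral>\<^sup>+z. corner_energy \<theta>1 \<theta>2 U S z * \<omega> z \<partial>lborel"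
  have refl: "(\<integral>\<^sup>+z. ?c (s * fst z, t * snd z) * \<omega> z \<partial>lborel) = ?I"
    if st: "\<bar>s\<bar> = 1" "\<bar>t\<bar> = 1" for s t :: real
  proof -
    have "s * s = 1" "t * t = 1"
      using st by (metis abs_mult_self_eq mult_1)+
    then have "norm (s * fst z, t * snd z) = norm z" for z :: "real \<times> real"
      by (cases z) (simp add: norm_Pair power2_eq_square algebra_simps)
    then have "\<omega> (s * fst z, t * snd z) = \<omega> z" for z :: "real \<times> real"
      by (rule rad)
    moreover have "?I = ennreal \<bar>s * t\<bar> * (\<integral>\<^sup>+z. ?c (s * fst z, t * snd z) * \<omega> (s * fst z, t * snd z) \<partial>lborel)"
      using st by (intro nn_integral_lborel_diag_scale) auto
    ultimately show ?thesis using st by (simp add: abs_mult)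
  qed
  have [measurable]: "(\<lambda>z. ?c (s * fst z, t * snd z)) \<in> borel_measurable borel" for s t :: real
  proof -
    have "(\<lambda>z. (s * fst z, t * snd z)) \<in> borel_measurable (borel :: (real \<times> real) measure)"
      by (intro borel_measurable_continuous_onI continuous_intros)
    then show ?thesis
      by (rule measurable_compose) measurable
  qed
  have "(\<integral>\<^sup>+z. sym_energy \<theta>1 \<theta>2 U S z * \<omega> z \<partial>lborel) =
      (\<integral>\<^sup>+z. ?c (1 * fst z, 1 * snd z) * \<omega> z + ?c ((-1) * fst z, 1 * snd z) * \<omega> z
        + ?c (1 * fst z, (-1) * snd z) * \<omega> z + ?c ((-1) * fst z, (-1) * snd z) * \<omega> z \<partial>lborel)"
    by (simp add: sym_energy_def distrib_right)
  also have "\<dots> = (\<integral>\<^sup>+z. ?c (1 * fst z, 1 * snd z) * \<omega> z \<partial>lborel) + (\<integral>\<^sup>+z. ?c ((-1) * fst z, 1 * snd z) * \<omega> z \<partial>lborel)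
      + (\<integral>\<^sup>+z. ?c (1 * fst z, (-1) * snd z) * \<omega> z \<partial>lborel) + (\<integral>\<^sup>+z. ?c ((-1) * fst z, (-1) * snd z) * \<omega> z \<partial>lborel)"
    by (subst nn_integral_add; measurable)+
  also have "\<dots> = ?I + ?I + ?I + ?I"
    by (simp only: refl abs_minus_cancel abs_one)
  also have "\<dots> = 4 * ?I"
    by (metis (no_types, lifting) add.assoc mult_2 mult_2_right numeral_Bit0 distrib_right one_add_one)
  finally show ?thesis .
qed

text \<open>Lets the steps be taken positive: passing to absolute values merely permutes the four
  terms.\<close>

lemma sym_energy_abs: "sym_energy \<theta>1 \<theta>2 U S (\<bar>fst z\<bar>, \<bar>snd z\<bar>) = sym_energy \<theta>1 \<theta>2 U S z"
  unfolding sym_energy_def fst_conv snd_conv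
  by (cases "fst z \<ge> 0"; cases "snd z \<ge> 0"; simp only: abs_of_nonneg abs_of_neg not_le minus_minus) (simp_all only: add_ac)

lemma sym_energy_measurable [measurable]:
  assumes [measurable]: "U \<in> borel_measurable borel" "S \<in> sets borel"
  shows "sym_energy \<theta>1 \<theta>2 U S \<in> borel_measurable borel"
proof -
  have "(\<lambda>z. corner_energy \<theta>1 \<theta>2 U S (s * fst z, t * snd z)) \<in> borel_measurable borel" for s t :: real
  proof -
    have "(\<lambda>z. (s * fst z, t * snd z)) \<in> borel_measurable (borel :: (real \<times> real) measure)"
      by (intro borel_measurable_continuous_onI continuous_intros)
    then show ?thesis
      by (rule measurable_compose) measurable
  qed
  from this[of 1 1] this[of "-1" 1] this[of 1 "-1"] this[of "-1" "-1"]
  show ?thesis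
    unfolding sym_energy_def by simp
qed

section \<open>Rectangles of bounded eccentricity\<close>

lemma AE_off_axes: "AE z in lborel. fst z \<noteq> (0::real) \<and> snd z \<noteq> (0::real)"
proof -
  have "{0::real} \<times> (UNIV :: real set) \<in> null_sets (lborel \<Otimes>\<^sub>M lborel)"
    by (rule lborel.times_in_null_sets1) auto
  moreover have "(UNIV :: real set) \<times> {0::real} \<in> null_sets (lborel \<Otimes>\<^sub>M lborel)"
    by (rule lborel.times_in_null_sets2) auto
  ultimately have "AE z in lborel. z \<notin> {0::real} \<times> (UNIV :: real set)" "AE z in lborel. z \<notin> (UNIV :: real set) \<times> {0::real}"
    unfolding lborel_prod by (simp_all only: AE_not_in)
  then show ?thesis
    by eventually_elim auto
qed

text \<open>Increments whose rectangle has area comparable to its squared diagonal. This trades the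
  weight \<open>1 / (norm z)\<^sup>2\<close> of the energy for the reciprocal area that lattice sums
  need.\<close>

definition diagonal_cone :: "real \<Rightarrow> (real \<times> real) set" where
  "diagonal_cone c = {z. c * (norm z)\<^sup>2 < \<bar>fst z * snd z\<bar>}"

lemma diagonal_cone_borel [measurable]: "diagonal_cone c \<in> sets borel"
  unfolding diagonal_cone_def by (intro borel_open open_Collect_less continuous_intros)

text \<open>As \<open>c\<close> decreases to 0 the cones exhaust the complement of the axes, which
  are null; if no cone with \<open>c = 1 / (n + 1)\<close> had mass, \<rho> would vanish almost
  everywhere.\<close>

lemma diagonal_cone_mass:
  fixes \<rho> :: "real \<times> real \<Rightarrow> real"
  assumes [measurable]: "\<rho> \<in> borel_measurable borel"
    and pos: "(\<integral>\<^sup>+z. ennreal (\<rho> z) \<partial>lborel) \<noteq> 0"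
  obtains c \<kappa> where "c > 0" "\<kappa> > 0" "ennreal \<kappa> \<le> (\<integral>\<^sup>+z. indicator (diagonal_cone c) z * ennreal (\<rho> z) \<partial>lborel)"
proof -
  let ?I = "\<lambda>c. \<integral>\<^sup>+z. indicator (diagonal_cone c) z * ennreal (\<rho> z) \<partial>lborel"
  have "\<exists>n. ?I (inverse (real (Suc n))) \<noteq> 0"
  proof (rule ccontr)
    assume "\<not> ?thesis"
    then have "AE z in lborel. indicator (diagonal_cone (inverse (real (Suc n)))) z * ennreal (\<rho> z) = 0" for n
      by (subst nn_integral_0_iff_AE[symmetric]) auto
    then have "AE z in lborel. \<forall>n. indicator (diagonal_cone (inverse (real (Suc n)))) z * ennreal (\<rho> z) = 0"
      by (simp only: AE_all_countable) blast
    with AE_off_axes have "AE z in lborel. ennreal (\<rho> z) = 0"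
    proof eventually_elim
      case (elim z)
      have "(norm z)\<^sup>2 > 0" "\<bar>fst z * snd z\<bar> > 0"
        using elim(1) by (cases z; auto simp: zero_prod_def)+
      then have "\<bar>fst z * snd z\<bar> / (norm z)\<^sup>2 > 0"
        by simp
      then obtain n where "inverse (real (Suc n)) < \<bar>fst z * snd z\<bar> / (norm z)\<^sup>2"
        using reals_Archimedean by blast
      then have "z \<in> diagonal_cone (inverse (real (Suc n)))"
        using \<open>(norm z)\<^sup>2 > 0\<close> by (simp add: diagonal_cone_def pos_less_divide_eq)
      then show ?case
        using elim(2)[rule_format, of n] by simp
    qed
    then have "(\<integral>\<^sup>+z. ennreal (\<rho> z) \<partial>lborel) = 0"
      by (subst nn_integral_0_iff_AE) auto
    then show False using pos by simp
  qed
  then obtain n where "?I (inverse (real (Suc n))) \<noteq> 0" by blast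
  then have "0 < ?I (inverse (real (Suc n)))"
    using zero_less_iff_neq_zero by blast
  then obtain b where b: "0 < b" "b < ?I (inverse (real (Suc n)))"
    using dense by blast
  then obtain \<kappa> where "b = ennreal \<kappa>" "\<kappa> > 0"
    by (cases b) auto
  then show ?thesis
    using that[of "inverse (real (Suc n))" \<kappa>] b by auto
qed

text \<open>Averaging over the increments in the cone, whose mass is at least \<kappa>. The 8 is 4
  for the reflections times 2 for slack, so that failure of every pair of steps would give
  \<open>8 * L <= 4 * L\<close>.\<close>

lemma select_steps:
  fixes \<rho> :: "real \<times> real \<Rightarrow> real"
  assumes \<rho>_meas [measurable]: "\<rho> \<in> borel_measurable borel"
    and \<rho>: "\<And>z. \<rho> z \<ge> 0" "\<And>z. norm z > 1 \<Longrightarrow> \<rho> z = 0" "\<And>z w. norm z = norm w \<Longrightarrow> \<rho> z = \<rho> w"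
    and c: "c > 0" "\<kappa> > 0" "ennreal \<kappa> \<le> (\<integral>\<^sup>+z. indicator (diagonal_cone c) z * ennreal (\<rho> z) \<partial>lborel)"
    and \<epsilon>: "\<epsilon> > 0"
    and U [measurable]: "U \<in> borel_measurable borel" and eq: "\<And>x. x \<in> box2 a1 b1 a2 b2 \<Longrightarrow> U x = u x"
    and L: "L > 0" "E_eps \<theta>1 \<theta>2 \<rho> a1 b1 a2 b2 u \<epsilon> \<le> ennreal L"
  obtains h1 h2 where "0 < h1" "h1 \<le> \<epsilon>" "0 < h2" "h2 \<le> \<epsilon>"
    "sym_energy \<theta>1 \<theta>2 U (inner_box a1 b1 a2 b2 \<epsilon>) (h1, h2) \<le> ennreal (8 * L / (\<kappa> * c) * (h1 * h2))"
proof (rule ccontr)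
  note found = that
  assume neg: "\<not> thesis"
  let ?J = "sym_energy \<theta>1 \<theta>2 U (inner_box a1 b1 a2 b2 \<epsilon>)"
  let ?r = "rho_eps \<rho> \<epsilon>"
  have r_meas [measurable]: "?r \<in> borel_measurable borel"
    unfolding rho_eps_def by measurable
  have r_nonneg: "?r z \<ge> 0" for z
    using \<rho>(1) by (simp add: rho_eps_def)
  have r_rad: "?r z = ?r w" if "norm z = norm w" for z w
    unfolding rho_eps_def using that by (subst \<rho>(3)[of "(1 / \<epsilon>) *\<^sub>R z" "(1 / \<epsilon>) *\<^sub>R w"]) auto
  \<comment> \<open>The left side is 0 outside the cone and, through the kernel, outside the ball of
    radius \<epsilon>; elsewhere the failing bound combines with the area bound that defines the
    cone.\<close>
  have big: "ennreal (8 * L / \<kappa>) * (indicator (diagonal_cone c) z * ennreal (?r z)) \<le> ?J z * ennreal (?r z / (norm z)\<^sup>2)" for z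
  proof (cases "z \<in> diagonal_cone c \<and> norm z \<le> \<epsilon>")
    case True
    have prod: "c * (norm z)\<^sup>2 < \<bar>fst z\<bar> * \<bar>snd z\<bar>"
      using True by (simp add: diagonal_cone_def abs_mult)
    moreover have "0 \<le> c * (norm z)\<^sup>2" using c(1) by simp
    ultimately have nz: "fst z \<noteq> 0" "snd z \<noteq> 0" by auto
    have nz': "(norm z)\<^sup>2 > 0" using nz by auto
    have "\<bar>fst z\<bar> \<le> \<epsilon>" "\<bar>snd z\<bar> \<le> \<epsilon>"
      using True norm_fst_le[of "fst z" "snd z"] norm_snd_le[of "snd z" "fst z"] by auto
    then have "\<not> ?J (\<bar>fst z\<bar>, \<bar>snd z\<bar>) \<le> ennreal (8 * L / (\<kappa> * c) * (\<bar>fst z\<bar> * \<bar>snd z\<bar>))"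
      using neg found[of "\<bar>fst z\<bar>" "\<bar>snd z\<bar>"] nz by auto
    then have J: "ennreal (8 * L / (\<kappa> * c) * (\<bar>fst z\<bar> * \<bar>snd z\<bar>)) \<le> ?J z"
      by (simp add: sym_energy_abs)
    have "8 * L / \<kappa> * (norm z)\<^sup>2 = 8 * L / (\<kappa> * c) * (c * (norm z)\<^sup>2)"
      using c by (simp add: field_simps)
    also have "\<dots> \<le> 8 * L / (\<kappa> * c) * (\<bar>fst z\<bar> * \<bar>snd z\<bar>)"
      using prod c L(1) by (intro mult_left_mono) auto
    finally have "ennreal (8 * L / \<kappa> * (norm z)\<^sup>2) \<le> ?J z"
      using J by (meson ennreal_leI order_trans)
    then have "ennreal (8 * L / \<kappa> * (norm z)\<^sup>2) * ennreal (?r z / (norm z)\<^sup>2) \<le> ?J z * ennreal (?r z / (norm z)\<^sup>2)"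
      by (rule mult_right_mono) simp
    moreover have "ennreal (8 * L / \<kappa> * (norm z)\<^sup>2) * ennreal (?r z / (norm z)\<^sup>2) = ennreal (8 * L / \<kappa>) * ennreal (?r z)"
      using nz' c L(1) r_nonneg[of z] by (subst (1 2) ennreal_mult[symmetric]) (auto simp: field_simps)
    ultimately show ?thesis using True by simp
  next
    case False
    then show ?thesis
      using rho_eps_outside[OF \<rho>(2) \<epsilon>, where z = z] by (auto simp: not_le)
  qed
  \<comment> \<open>Cones are invariant under dilation and \<open>rho_eps\<close> preserves mass, so
    one \<kappa> works for all \<epsilon>.\<close>
  have scale: "(\<integral>\<^sup>+z. indicator (diagonal_cone c) z * ennreal (?r z) \<partial>lborel) = (\<integral>\<^sup>+z. indicator (diagonal_cone c) z * ennreal (\<rho> z) \<partial>lborel)"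
  proof -
    have cone: "indicator (diagonal_cone c) (\<epsilon> * fst z, \<epsilon> * snd z) = (indicator (diagonal_cone c) z :: ennreal)" for z
    proof -
      have "norm (\<epsilon> * fst z, \<epsilon> * snd z) = \<epsilon> * norm z"
      proof -
        have "(\<epsilon> * fst z, \<epsilon> * snd z) = \<epsilon> *\<^sub>R z" by (cases z) simp
        then show ?thesis using \<epsilon> by simp
      qed
      then have "c * (norm (\<epsilon> * fst z, \<epsilon> * snd z))\<^sup>2 = \<epsilon>\<^sup>2 * (c * (norm z)\<^sup>2)"
        "\<bar>fst (\<epsilon> * fst z, \<epsilon> * snd z) * snd (\<epsilon> * fst z, \<epsilon> * snd z)\<bar> = \<epsilon>\<^sup>2 * \<bar>fst z * snd z\<bar>"
        using \<epsilon> by (simp_all add: power_mult_distrib abs_mult power2_eq_square)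
      then have "(\<epsilon> * fst z, \<epsilon> * snd z) \<in> diagonal_cone c \<longleftrightarrow> z \<in> diagonal_cone c"
        unfolding diagonal_cone_def mem_Collect_eq using \<epsilon> by (simp only: mult_less_cancel_left_pos zero_less_power)
      then show ?thesis by (simp add: indicator_def)
    qed
    have r: "ennreal (?r (\<epsilon> * fst z, \<epsilon> * snd z)) = ennreal (\<rho> z) * ennreal (1 / \<epsilon>\<^sup>2)" for z
    proof -
      have "(1 / \<epsilon>) *\<^sub>R (\<epsilon> * fst z, \<epsilon> * snd z) = z"
        using \<epsilon> by (cases z) simp
      then show ?thesis
        using \<rho>(1) by (simp add: rho_eps_def ennreal_mult[symmetric])
    qed
    have "(\<integral>\<^sup>+z. indicator (diagonal_cone c) z * ennreal (?r z) \<partial>lborel)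
        = ennreal \<bar>\<epsilon> * \<epsilon>\<bar> * (\<integral>\<^sup>+z. (indicator (diagonal_cone c) z * ennreal (\<rho> z)) * ennreal (1 / \<epsilon>\<^sup>2) \<partial>lborel)"
      using \<epsilon> by (subst nn_integral_lborel_diag_scale[of _ \<epsilon> \<epsilon>]) (auto simp: cone r mult.assoc)
    also have "\<dots> = ennreal \<bar>\<epsilon> * \<epsilon>\<bar> * ((\<integral>\<^sup>+z. indicator (diagonal_cone c) z * ennreal (\<rho> z) \<partial>lborel) * ennreal (1 / \<epsilon>\<^sup>2))"
      by (subst nn_integral_multc) auto
    also have "\<dots> = (ennreal \<bar>\<epsilon> * \<epsilon>\<bar> * ennreal (1 / \<epsilon>\<^sup>2)) * (\<integral>\<^sup>+z. indicator (diagonal_cone c) z * ennreal (\<rho> z) \<partial>lborel)"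
      by (simp only: mult_ac)
    also have "ennreal \<bar>\<epsilon> * \<epsilon>\<bar> * ennreal (1 / \<epsilon>\<^sup>2) = 1"
      using \<epsilon> by (subst ennreal_mult[symmetric]) (auto simp: power2_eq_square)
    finally show ?thesis by simp
  qed
  have "ennreal (8 * L) = ennreal (8 * L / \<kappa>) * ennreal \<kappa>"
    using c L(1) by (subst ennreal_mult[symmetric]) auto
  also have "\<dots> \<le> ennreal (8 * L / \<kappa>) * (\<integral>\<^sup>+z. indicator (diagonal_cone c) z * ennreal (?r z) \<partial>lborel)"
    unfolding scale by (intro mult_left_mono c(3)) simp
  also have "\<dots> = (\<integral>\<^sup>+z. ennreal (8 * L / \<kappa>) * (indicator (diagonal_cone c) z * ennreal (?r z)) \<partial>lborel)"
    by (rule nn_integral_cmult[symmetric]) measurable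
  also have "\<dots> \<le> (\<integral>\<^sup>+z. ?J z * ennreal (?r z / (norm z)\<^sup>2) \<partial>lborel)"
    by (intro nn_integral_mono big)
  also have "\<dots> = 4 * E_eps \<theta>1 \<theta>2 \<rho> a1 b1 a2 b2 u \<epsilon>"
  proof -
    have "E_eps \<theta>1 \<theta>2 \<rho> a1 b1 a2 b2 u \<epsilon> = (\<integral>\<^sup>+z. corner_energy \<theta>1 \<theta>2 U (inner_box a1 b1 a2 b2 \<epsilon>) z
        * ennreal (?r z / (norm z)\<^sup>2) \<partial>lborel)"
      by (rule E_eps_eq_corner_energy[where U = U and u = u, OF \<rho>(1,2) \<epsilon> U eq])
    moreover have "(\<integral>\<^sup>+z. ?J z * ennreal (?r z / (norm z)\<^sup>2) \<partial>lborel) =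
        4 * (\<integral>\<^sup>+z. corner_energy \<theta>1 \<theta>2 U (inner_box a1 b1 a2 b2 \<epsilon>) z * ennreal (?r z / (norm z)\<^sup>2) \<partial>lborel)"
    proof (rule nn_integral_sym_energy[OF U inner_box_borel])
      show "(\<lambda>z. ennreal (?r z / (norm z)\<^sup>2)) \<in> borel_measurable borel"
        by measurable
      show "ennreal (?r z / (norm z)\<^sup>2) = ennreal (?r w / (norm w)\<^sup>2)" if "norm z = norm w" for z w
        using r_rad[OF that] that by simp
    qed
    ultimately show ?thesis by simp
  qed
  also have "\<dots> \<le> 4 * ennreal L"
    by (intro mult_left_mono L(2)) simp
  also have "\<dots> = ennreal (4 * L)"
    using L(1) by (simp add: ennreal_mult)
  finally show False
    using L(1) by simp
qed

text \<open>The corner inequality is integrated over the base point; each of its four products is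
  the energy density seen from one corner, and translation invariance allows each corner in turn to
  serve as base point.\<close>

lemma nn_integral_D12_le:
  fixes U :: "real \<times> real \<Rightarrow> real"
  assumes \<theta>: "\<theta>1 > 0" "\<theta>2 > 0" "\<theta>1 + \<theta>2 \<le> 1"
    and [measurable]: "U \<in> borel_measurable borel" "S \<in> sets borel"
  shows "(\<integral>\<^sup>+x. indicator {x. x \<in> S \<and> x + (h1, 0) \<in> S \<and> x + (0, h2) \<in> S \<and> x + (h1, h2) \<in> S} x *
      ennreal (\<bar>D12 h1 h2 U x\<bar> powr (\<theta>1 + \<theta>2)) \<partial>lborel) \<le> 2 * sym_energy \<theta>1 \<theta>2 U S (h1, h2)"
proof -
  define g where "g s t x = (indicator S x *
     ennreal (\<bar>U (x + (s, 0)) - U x\<bar> powr \<theta>1 * \<bar>U (x + (0, t)) - U x\<bar> powr \<theta>2) :: ennreal)" for s t x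
  have g_meas [measurable]: "g s t \<in> borel_measurable borel" for s t
    unfolding g_def by measurable
  have g: "(\<integral>\<^sup>+x. g s t (x + v) \<partial>lborel) = corner_energy \<theta>1 \<theta>2 U S (s, t)" for s t v
    by (subst nn_integral_lborel_translate) (measurable, simp add: corner_energy_def g_def[abs_def])
  have "indicator {x. x \<in> S \<and> x + (h1, 0) \<in> S \<and> x + (0, h2) \<in> S \<and> x + (h1, h2) \<in> S} x *
      ennreal (\<bar>D12 h1 h2 U x\<bar> powr (\<theta>1 + \<theta>2))
    \<le> 2 * (g h1 h2 (x + 0) + g (-h1) h2 (x + (h1, 0)) + g h1 (-h2) (x + (0, h2)) + g (-h1) (-h2) (x + (h1, h2)))" for x
  proof (cases "x \<in> S \<and> x + (h1, 0) \<in> S \<and> x + (0, h2) \<in> S \<and> x + (h1, h2) \<in> S")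
    case True
    \<comment> \<open>Values at the four corners. Reflecting \<open>h1\<close> or \<open>h2\<close>
      below makes both increments start at the corner concerned and run along its sides.\<close>
    define p where "p = U x"
    define q where "q = U (x + (h1, 0))"
    define r where "r = U (x + (0, h2))"
    define s where "s = U (x + (h1, h2))"
    have *: "\<bar>D12 h1 h2 U x\<bar> powr (\<theta>1 + \<theta>2) \<le> 2 * (\<bar>q - p\<bar> powr \<theta>1 * \<bar>r - p\<bar> powr \<theta>2
        + \<bar>q - p\<bar> powr \<theta>1 * \<bar>s - q\<bar> powr \<theta>2 + \<bar>s - r\<bar> powr \<theta>1 * \<bar>r - p\<bar> powr \<theta>2
        + \<bar>s - r\<bar> powr \<theta>1 * \<bar>s - q\<bar> powr \<theta>2)"
      by (rule corner_inequality[OF \<theta>]) (simp_all add: D12_def p_def q_def r_def s_def)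
    have v: "x + (h1, 0) + (- h1, 0) = x" "x + (h1, 0) + (0, h2) = x + (h1, h2)"
      "x + (0, h2) + (h1, 0) = x + (h1, h2)" "x + (0, h2) + (0, - h2) = x"
      "x + (h1, h2) + (- h1, 0) = x + (0, h2)" "x + (h1, h2) + (0, - h2) = x + (h1, 0)"
      by (simp_all add: add.assoc zero_prod_def[symmetric])
    have "g h1 h2 (x + 0) = ennreal (\<bar>q - p\<bar> powr \<theta>1 * \<bar>r - p\<bar> powr \<theta>2)"
      "g (-h1) h2 (x + (h1, 0)) = ennreal (\<bar>q - p\<bar> powr \<theta>1 * \<bar>s - q\<bar> powr \<theta>2)"
      "g h1 (-h2) (x + (0, h2)) = ennreal (\<bar>s - r\<bar> powr \<theta>1 * \<bar>r - p\<bar> powr \<theta>2)"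
      "g (-h1) (-h2) (x + (h1, h2)) = ennreal (\<bar>s - r\<bar> powr \<theta>1 * \<bar>s - q\<bar> powr \<theta>2)"
      using True unfolding g_def v p_def q_def r_def s_def by (simp_all add: abs_minus_commute)
    then have "2 * (g h1 h2 (x + 0) + g (-h1) h2 (x + (h1, 0)) + g h1 (-h2) (x + (0, h2)) + g (-h1) (-h2) (x + (h1, h2)))
      = ennreal (2 * (\<bar>q - p\<bar> powr \<theta>1 * \<bar>r - p\<bar> powr \<theta>2
        + \<bar>q - p\<bar> powr \<theta>1 * \<bar>s - q\<bar> powr \<theta>2 + \<bar>s - r\<bar> powr \<theta>1 * \<bar>r - p\<bar> powr \<theta>2
        + \<bar>s - r\<bar> powr \<theta>1 * \<bar>s - q\<bar> powr \<theta>2))"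
      by (simp add: ennreal_mult)
    then show ?thesis
      using True ennreal_leI[OF *] by simp
  next
    case False
    then show ?thesis by simp
  qed
  then have "(\<integral>\<^sup>+x. indicator {x. x \<in> S \<and> x + (h1, 0) \<in> S \<and> x + (0, h2) \<in> S \<and> x + (h1, h2) \<in> S} x *
      ennreal (\<bar>D12 h1 h2 U x\<bar> powr (\<theta>1 + \<theta>2)) \<partial>lborel)
    \<le> (\<integral>\<^sup>+x. 2 * (g h1 h2 (x + 0) + g (-h1) h2 (x + (h1, 0)) + g h1 (-h2) (x + (0, h2)) + g (-h1) (-h2) (x + (h1, h2))) \<partial>lborel)"
    by (intro nn_integral_mono)
  also have "\<dots> = 2 * ((\<integral>\<^sup>+x. g h1 h2 (x + 0) \<partial>lborel) + (\<integral>\<^sup>+x. g (-h1) h2 (x + (h1, 0)) \<partial>lborel)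
      + (\<integral>\<^sup>+x. g h1 (-h2) (x + (0, h2)) \<partial>lborel) + (\<integral>\<^sup>+x. g (-h1) (-h2) (x + (h1, h2)) \<partial>lborel))"
    by (subst nn_integral_cmult, measurable) (subst nn_integral_add; measurable)+
  also have "\<dots> = 2 * sym_energy \<theta>1 \<theta>2 U S (h1, h2)"
    unfolding g sym_energy_def by simp
  finally show ?thesis .
qed

text \<open>One offset must satisfy both bounds, so the two densities are normalised and added: the
  mean is at most 2, and asking for less than 3 supplies the strict inequality that averaging
  needs.\<close>

lemma exists_good_lattice:
  assumes h: "h1 > 0" "h2 > 0" and A: "A > 0" "B > 0"
    and f [measurable]: "f \<in> borel_measurable borel" "g \<in> borel_measurable borel"
    and le: "(\<integral>\<^sup>+x. f x \<partial>lborel) \<le> ennreal (A * (h1 * h2))" "(\<integral>\<^sup>+x. g x \<partial>lborel) \<le> ennreal (B * (h1 * h2))"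
    and N: "N \<in> null_sets lborel"
  obtains x0 where "(\<integral>\<^sup>+p. f (x0 + lat h1 h2 p) \<partial>count_space UNIV) \<le> ennreal (3 * A)"
    "(\<integral>\<^sup>+p. g (x0 + lat h1 h2 p) \<partial>count_space UNIV) \<le> ennreal (3 * B)"
    "\<And>p. x0 + lat h1 h2 p \<notin> N"
proof -
  have N' [measurable]: "N \<in> sets borel" and N0: "emeasure lborel N = 0"
    using N by auto
  \<comment> \<open>the infinite weight on \<open>N\<close> makes the lattice avoid \<open>N\<close>\<close>
  define k where "k x = ennreal (1 / A) * f x + ennreal (1 / B) * g x + top * indicator N x" for x
  have k_meas: "k \<in> borel_measurable borel"
    unfolding k_def by measurable
  have "(\<integral>\<^sup>+x. k x \<partial>lborel) = ennreal (1 / A) * (\<integral>\<^sup>+x. f x \<partial>lborel) + ennreal (1 / B) * (\<integral>\<^sup>+x. g x \<partial>lborel)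
      + top * emeasure lborel N"
    unfolding k_def
    by (simp add: nn_integral_add nn_integral_cmult nn_integral_cmult_indicator)
  also have "\<dots> \<le> ennreal (1 / A) * ennreal (A * (h1 * h2)) + ennreal (1 / B) * ennreal (B * (h1 * h2))"
    using le N0 by (auto intro!: add_mono mult_left_mono)
  also have "\<dots> = ennreal (2 * (h1 * h2))"
    using h A by (simp add: ennreal_mult[symmetric] ennreal_plus[symmetric] del: ennreal_plus)
  also have "\<dots> < ennreal (3 * (h1 * h2))"
    using h by (intro ennreal_lessI) auto
  finally obtain x0 where x0: "(\<integral>\<^sup>+p. k (x0 + lat h1 h2 p) \<partial>count_space UNIV) < ennreal 3"
    using exists_good_lattice_offset[OF h k_meas, of 3] by auto
  have part: "(\<integral>\<^sup>+p. q (x0 + lat h1 h2 p) \<partial>count_space UNIV) \<le> ennreal (3 * D)"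
    if "D > 0" "\<And>x. ennreal (1 / D) * q x \<le> k x" for D and q :: "real \<times> real \<Rightarrow> ennreal"
  proof -
    have "(\<integral>\<^sup>+p. q (x0 + lat h1 h2 p) \<partial>count_space UNIV)
        = (\<integral>\<^sup>+p. ennreal D * (ennreal (1 / D) * q (x0 + lat h1 h2 p)) \<partial>count_space UNIV)"
      using that(1) by (simp add: mult.assoc[symmetric] ennreal_mult[symmetric])
    also have "\<dots> = ennreal D * (\<integral>\<^sup>+p. ennreal (1 / D) * q (x0 + lat h1 h2 p) \<partial>count_space UNIV)"
      by (rule nn_integral_cmult) simp
    also have "\<dots> \<le> ennreal D * (\<integral>\<^sup>+p. k (x0 + lat h1 h2 p) \<partial>count_space UNIV)"
      by (intro mult_left_mono nn_integral_mono that) simp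
    also have "\<dots> \<le> ennreal D * ennreal 3"
      using x0 by (intro mult_left_mono) auto
    also have "\<dots> = ennreal (3 * D)"
      using that(1) by (simp add: ennreal_mult mult.commute)
    finally show ?thesis .
  qed
  show ?thesis
  proof (rule that)
    show "(\<integral>\<^sup>+p. f (x0 + lat h1 h2 p) \<partial>count_space UNIV) \<le> ennreal (3 * A)"
      by (rule part[OF A(1)]) (simp add: k_def add.assoc)
    show "(\<integral>\<^sup>+p. g (x0 + lat h1 h2 p) \<partial>count_space UNIV) \<le> ennreal (3 * B)"
      by (rule part[OF A(2)]) (simp add: k_def add.assoc add.left_commute)
    fix p
    have "k (x0 + lat h1 h2 p) \<le> (\<integral>\<^sup>+p. k (x0 + lat h1 h2 p) \<partial>count_space UNIV)"
      by (rule nn_integral_ge_point) simp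
    also have "\<dots> < top" using x0 by (rule order.strict_trans) simp
    finally show "x0 + lat h1 h2 p \<notin> N"
      by (auto simp: k_def)
  qed
qed

section \<open>Atomic approximation and the limit\<close>

text \<open>The atoms are chosen before \<phi>, and the error depends on \<phi> only through
  \<open>M\<close>; hence one sequence of atomic measures can be tested against all functions. Only
  cells with all corners in the inner box carry atoms, because the energy controls no
  others.\<close>

lemma approximating_atoms:
  fixes \<rho> u U :: "real \<times> real \<Rightarrow> real"
  assumes \<theta>: "\<theta>1 > 0" "\<theta>2 > 0" "\<theta>1 + \<theta>2 \<le> 1"
    and \<rho>_meas: "\<rho> \<in> borel_measurable borel"
    and \<rho>: "\<And>z. \<rho> z \<ge> 0" "\<And>z. norm z > 1 \<Longrightarrow> \<rho> z = 0" "\<And>z w. norm z = norm w \<Longrightarrow> \<rho> z = \<rho> w"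
    and c: "c > 0" "\<kappa> > 0" "ennreal \<kappa> \<le> (\<integral>\<^sup>+z. indicator (diagonal_cone c) z * ennreal (\<rho> z) \<partial>lborel)"
    and \<epsilon>: "\<epsilon> > 0"
    and U: "integrable lborel U" "\<And>x. x \<in> box2 a1 b1 a2 b2 \<Longrightarrow> U x = u x" "\<And>x. x \<notin> box2 a1 b1 a2 b2 \<Longrightarrow> U x = 0"
    and L: "L > 0" "E_eps \<theta>1 \<theta>2 \<rho> a1 b1 a2 b2 u \<epsilon> \<le> ennreal L"
    and \<eta>: "\<eta> > 0" "\<And>t. norm t \<le> 2 * \<epsilon> \<Longrightarrow> L1_modulus U t \<le> ennreal \<eta>"
    and N: "N \<in> null_sets lborel"
  obtains S :: "(int \<times> int) set" and w :: "int \<times> int \<Rightarrow> real" and P :: "int \<times> int \<Rightarrow> real \<times> real"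
  where "finite S" "(\<Sum>p\<in>S. \<bar>w p\<bar> powr (\<theta>1 + \<theta>2)) \<le> 48 / (\<kappa> * c) * L"
    "\<And>p. p \<in> S \<Longrightarrow> P p \<in> box2 a1 b1 a2 b2"
    "\<And>p. p \<in> S \<Longrightarrow> (\<And>x. x \<in> box2 a1 b1 a2 b2 \<Longrightarrow> x \<notin> N \<Longrightarrow> u x \<in> \<int>) \<Longrightarrow> w p \<in> \<int>"
    "\<And>\<phi> M. smooth2 \<phi> \<Longrightarrow> integrable lborel (pds [True, False] \<phi>) \<Longrightarrow> M > 0 \<Longrightarrow>
       (\<And>x. \<bar>pds [True, False] \<phi> x\<bar> \<le> M) \<Longrightarrow>
       (\<And>x s t. \<phi> x \<noteq> 0 \<Longrightarrow> \<bar>s\<bar> \<le> \<epsilon> \<Longrightarrow> \<bar>t\<bar> \<le> \<epsilon> \<Longrightarrow> x + (s, t) \<in> inner_box a1 b1 a2 b2 \<epsilon>) \<Longrightarrow>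
       \<bar>(\<integral>x. U x * pds [True, False] \<phi> x \<partial>lborel) - (\<Sum>p\<in>S. w p * \<phi> (P p))\<bar> \<le> M * (3 * \<eta>)"
proof -
  let ?\<Omega> = "box2 a1 b1 a2 b2" and ?S = "inner_box a1 b1 a2 b2 \<epsilon>"
  have U_meas [measurable]: "U \<in> borel_measurable borel" using U(1) by simp
  obtain h1 h2 where h: "0 < h1" "h1 \<le> \<epsilon>" "0 < h2" "h2 \<le> \<epsilon>"
    and J: "sym_energy \<theta>1 \<theta>2 U ?S (h1, h2) \<le> ennreal (8 * L / (\<kappa> * c) * (h1 * h2))"
    using select_steps[OF \<rho>_meas \<rho> c \<epsilon> U_meas U(2) L] by metis
  define F where "F x = (indicator {x. x \<in> ?S \<and> x + (h1, 0) \<in> ?S \<and> x + (0, h2) \<in> ?S \<and> x + (h1, h2) \<in> ?S} x *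
      ennreal (\<bar>D12 h1 h2 U x\<bar> powr (\<theta>1 + \<theta>2)) :: ennreal)" for x
  have F_meas: "F \<in> borel_measurable borel"
    unfolding F_def D12_def by measurable
  \<comment> \<open>Twice the constant of the selected steps, by the corner inequality; the choice
    of the offset triples it, which makes 48.\<close>
  define A where "A = 16 * L / (\<kappa> * c)"
  have A: "A > 0" using L c by (simp add: A_def)
  have "(\<integral>\<^sup>+x. F x \<partial>lborel) \<le> 2 * sym_energy \<theta>1 \<theta>2 U ?S (h1, h2)"
    unfolding F_def by (rule nn_integral_D12_le[OF \<theta> U_meas inner_box_borel])
  also have "\<dots> \<le> 2 * ennreal (8 * L / (\<kappa> * c) * (h1 * h2))"
    by (intro mult_left_mono J) simp
  also have "\<dots> = ennreal (A * (h1 * h2))"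
    unfolding A_def using L c h by (subst ennreal_numeral[symmetric], subst ennreal_mult[symmetric]) auto
  finally have F: "(\<integral>\<^sup>+x. F x \<partial>lborel) \<le> ennreal (A * (h1 * h2))" .
  have osc: "(\<integral>\<^sup>+x. osc h1 h2 U x \<partial>lborel) \<le> ennreal (\<eta> * (h1 * h2))"
  proof (rule nn_integral_osc_le[OF U_meas h(1,3)])
    fix t assume "t \<in> tile h1 h2"
    then have "\<bar>fst t\<bar> \<le> \<epsilon>" "\<bar>snd t\<bar> \<le> \<epsilon>"
      using h by (auto simp: tile_def)
    \<comment> \<open>Each coordinate is at most \<epsilon>, whence the radius
      \<open>2 * \<epsilon>\<close> in the hypothesis on the modulus.\<close>
    then have "norm t \<le> 2 * \<epsilon>"
      using norm_Pair_le[of "fst t" "snd t"] by auto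
    then show "L1_modulus U t \<le> ennreal \<eta>" by (rule \<eta>(2))
  qed (use \<eta> in simp)
  obtain x0 where x0: "(\<integral>\<^sup>+p. F (x0 + lat h1 h2 p) \<partial>count_space UNIV) \<le> ennreal (3 * A)"
      "(\<integral>\<^sup>+p. osc h1 h2 U (x0 + lat h1 h2 p) \<partial>count_space UNIV) \<le> ennreal (3 * \<eta>)"
      "\<And>p. x0 + lat h1 h2 p \<notin> N"
    using exists_good_lattice[OF h(1,3) A \<eta>(1) F_meas osc_measurable[OF U_meas] F osc N] by blast
  define X where "X p = x0 + lat h1 h2 p" for p
  \<comment> \<open>Closed ranges: for a cell outside \<open>I\<close> the function vanishes also at
    the upper corners, as summation by parts requires.\<close>
  define I where "I = {p. \<exists>s\<in>{0..h1}. \<exists>t\<in>{0..h2}. X p + (s, t) \<in> ?\<Omega>}"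
  have I: "finite I"
    unfolding I_def X_def using h by (intro finite_lattice_cells) (auto simp: box2_def intro!: bounded_Times)
  define S where "S = {p \<in> I. X p \<in> ?S \<and> X p + (h1, 0) \<in> ?S \<and> X p + (0, h2) \<in> ?S \<and> X p + (h1, h2) \<in> ?S}"
  have S: "finite S" "S \<subseteq> I" using I by (auto simp: S_def)
  have sub: "?S \<subseteq> ?\<Omega>" using \<epsilon> by (intro inner_box_subset) simp
  have X_shift: "X p + (h1, h2) = X (p + (1, 1))" "X p + (h1, 0) = X (p + (1, 0))" "X p + (0, h2) = X (p + (0, 1))" for p
    by (simp_all add: X_def lat_shift add.assoc)
  show ?thesis
  proof (rule that[of S "\<lambda>p. D12 h1 h2 U (X p)" "\<lambda>p. X p + (h1, h2)"])
    show "finite S" by (rule S)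
    have "ennreal (\<Sum>p\<in>S. \<bar>D12 h1 h2 U (X p)\<bar> powr (\<theta>1 + \<theta>2)) = (\<Sum>p\<in>S. ennreal (\<bar>D12 h1 h2 U (X p)\<bar> powr (\<theta>1 + \<theta>2)))"
      by (rule sum_ennreal[symmetric]) simp
    also have "\<dots> = (\<Sum>p\<in>S. F (X p))"
      by (rule sum.cong) (auto simp: F_def S_def)
    also have "\<dots> = (\<integral>\<^sup>+p. F (X p) \<partial>count_space S)"
      using S(1) by (simp add: nn_integral_count_space_finite)
    also have "\<dots> \<le> (\<integral>\<^sup>+p. F (X p) \<partial>count_space UNIV)"
      by (subst nn_integral_count_space_indicator) (auto intro!: nn_integral_mono split: split_indicator)
    also have "\<dots> \<le> ennreal (3 * A)"
      using x0(1) by (simp add: X_def)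
    finally have "(\<Sum>p\<in>S. \<bar>D12 h1 h2 U (X p)\<bar> powr (\<theta>1 + \<theta>2)) \<le> 3 * A"
      using A by (subst (asm) ennreal_le_iff) auto
    then show "(\<Sum>p\<in>S. \<bar>D12 h1 h2 U (X p)\<bar> powr (\<theta>1 + \<theta>2)) \<le> 48 / (\<kappa> * c) * L"
      by (simp add: A_def)
  next
    fix p assume "p \<in> S"
    then show "X p + (h1, h2) \<in> ?\<Omega>" using sub by (auto simp: S_def)
  next
    fix p assume p: "p \<in> S" and int: "\<And>x. x \<in> ?\<Omega> \<Longrightarrow> x \<notin> N \<Longrightarrow> u x \<in> \<int>"
    \<comment> \<open>Here it matters that the lattice avoids \<open>N\<close>: the weights are
      built from values of \<open>u\<close> at individual points.\<close>
    have *: "U (X q) \<in> \<int>" if "X q \<in> ?S" for q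
    proof -
      have "X q \<in> ?\<Omega>" using that sub by blast
      then show ?thesis using int[of "X q"] x0(3)[of q] by (simp add: U(2) X_def)
    qed
    have "X p \<in> ?S" "X (p + (1, 1)) \<in> ?S" "X (p + (1, 0)) \<in> ?S" "X (p + (0, 1)) \<in> ?S"
      using p by (simp_all add: S_def X_shift)
    then show "D12 h1 h2 U (X p) \<in> \<int>"
      unfolding D12_def X_shift by (intro Ints_diff Ints_add *)
  next
    fix \<phi> :: "real \<times> real \<Rightarrow> real" and M
    assume \<phi>: "smooth2 \<phi>" "integrable lborel (pds [True, False] \<phi>)" "M > 0" "\<And>x. \<bar>pds [True, False] \<phi> x\<bar> \<le> M"
      and near: "\<And>x s t. \<phi> x \<noteq> 0 \<Longrightarrow> \<bar>s\<bar> \<le> \<epsilon> \<Longrightarrow> \<bar>t\<bar> \<le> \<epsilon> \<Longrightarrow> x + (s, t) \<in> ?S"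
    have out: "U (X p + (s, t)) = 0" if "p \<notin> I" "0 \<le> s" "s \<le> h1" "0 \<le> t" "t \<le> h2" for p s t
      using that by (intro U(3)) (auto simp: I_def)
    have "(\<Sum>p\<in>I. U (X p) * D12 h1 h2 \<phi> (X p)) = (\<Sum>p\<in>I. D12 h1 h2 U (X p) * \<phi> (X p + (h1, h2)))"
      unfolding X_def
    proof (rule summation_by_parts_lattice[OF I])
      fix p assume "p \<notin> I"
      note o = out[OF this, unfolded X_def]
      show "U (x0 + lat h1 h2 p) = 0" using o[of 0 0] h by (simp flip: zero_prod_def)
      show "U (x0 + lat h1 h2 p + (h1, 0)) = 0" "U (x0 + lat h1 h2 p + (0, h2)) = 0"
        "U (x0 + lat h1 h2 p + (h1, h2)) = 0" using h by (auto intro!: o)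
    qed
    also have "\<dots> = (\<Sum>p\<in>S. D12 h1 h2 U (X p) * \<phi> (X p + (h1, h2)))"
    \<comment> \<open>If \<phi> is nonzero at the upper corner of a cell, \<open>near\<close> places
      all four corners in the inner box; so the cells outside \<open>S\<close> drop out.\<close>
    proof (rule sum.mono_neutral_right[OF I S(2)], intro ballI)
      fix p assume p: "p \<in> I - S"
      have "\<phi> (X p + (h1, h2)) = 0"
      proof (rule ccontr)
        assume "\<phi> (X p + (h1, h2)) \<noteq> 0"
        note n = near[OF this]
        have "X p + (h1, h2) + (- h1, - h2) \<in> ?S" "X p + (h1, h2) + (0, - h2) \<in> ?S"
          "X p + (h1, h2) + (- h1, 0) \<in> ?S" "X p + (h1, h2) + (0, 0) \<in> ?S"
          using h by (auto intro!: n)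
        then have "p \<in> S"
          using p by (simp add: S_def add.assoc flip: zero_prod_def)
        then show False using p by blast
      qed
      then show "D12 h1 h2 U (X p) * \<phi> (X p + (h1, h2)) = 0" by simp
    qed
    finally have eq: "(\<Sum>p\<in>I. U (X p) * D12 h1 h2 \<phi> (X p)) = (\<Sum>p\<in>S. D12 h1 h2 U (X p) * \<phi> (X p + (h1, h2)))" .
    have "ennreal \<bar>(\<integral>x. U x * pds [True, False] \<phi> x \<partial>lborel) - (\<Sum>p\<in>I. U (X p) * D12 h1 h2 \<phi> (X p))\<bar>
        \<le> ennreal M * (\<integral>\<^sup>+p. osc h1 h2 U (X p) \<partial>count_space UNIV)"
      unfolding X_def
    proof (rule lattice_quadrature_error[OF \<phi>(1-4) U(1) h(1,3) I])
      fix p x assume p: "p \<notin> I" and "x - (x0 + lat h1 h2 p) \<in> tile h1 h2"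
      then have x: "x - X p \<in> tile h1 h2" by (simp add: X_def)
      have "U (X p + (fst (x - X p), snd (x - X p))) = 0"
        using x by (intro out[OF p]) (auto simp: tile_def mem_Times_iff)
      moreover have "X p + (fst (x - X p), snd (x - X p)) = x"
        by (simp add: prod_eq_iff)
      ultimately show "U x = 0" by simp
    qed
    also have "\<dots> \<le> ennreal M * ennreal (3 * \<eta>)"
      using x0(2) by (intro mult_left_mono) (auto simp: X_def)
    also have "\<dots> = ennreal (M * (3 * \<eta>))"
      using \<phi>(3) \<eta>(1) by (simp add: ennreal_mult)
    finally show "\<bar>(\<integral>x. U x * pds [True, False] \<phi> x \<partial>lborel) - (\<Sum>p\<in>S. D12 h1 h2 U (X p) * \<phi> (X p + (h1, h2)))\<bar> \<le> M * (3 * \<eta>)"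
      using \<phi>(3) \<eta>(1) by (subst (asm) ennreal_le_iff) (auto simp: eq)
  qed
qed

lemma finite_energy_atomic:
  fixes \<theta>1 \<theta>2 :: real and \<rho> u :: "real \<times> real \<Rightarrow> real"
  assumes \<theta>: "\<theta>1 > 0" "\<theta>2 > 0" "\<theta>1 + \<theta>2 < 1"
    and \<rho>_meas: "\<rho> \<in> borel_measurable borel"
    and \<rho>: "\<And>z. \<rho> z \<ge> 0" "\<And>z. norm z > 1 \<Longrightarrow> \<rho> z = 0" "\<And>z w. norm z = norm w \<Longrightarrow> \<rho> z = \<rho> w"
    and c: "c > 0" "\<kappa> > 0" "ennreal \<kappa> \<le> (\<integral>\<^sup>+z. indicator (diagonal_cone c) z * ennreal (\<rho> z) \<partial>lborel)"
    and u: "set_borel_measurable lborel (box2 a1 b1 a2 b2) u"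
      "AE x in lborel. x \<in> box2 a1 b1 a2 b2 \<longrightarrow> \<bar>u x\<bar> \<le> B"
    and E: "E_lim \<theta>1 \<theta>2 \<rho> a1 b1 a2 b2 u < \<infinity>"
  shows "\<exists>m :: real \<times> real \<Rightarrow> real.
        countable {x. m x \<noteq> 0} \<and> {x. m x \<noteq> 0} \<subseteq> box2 a1 b1 a2 b2 \<and>
        (\<forall>\<phi>. test_fun (box2 a1 b1 a2 b2) \<phi> \<longrightarrow>
           (\<integral>x. indicator (box2 a1 b1 a2 b2) x * u x * pds [True, False] \<phi> x \<partial>lborel)
             = (\<Sum>\<^sub>\<infinity>x. m x * \<phi> x)) \<and>
        (\<lambda>x. \<bar>m x\<bar> powr (\<theta>1 + \<theta>2)) summable_on UNIV \<and>
        ennreal (\<Sum>\<^sub>\<infinity>x. \<bar>m x\<bar> powr (\<theta>1 + \<theta>2)) \<le> ennreal (48 / (\<kappa> * c)) * E_lim \<theta>1 \<theta>2 \<rho> a1 b1 a2 b2 u \<and>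
        ((AE x in lborel. x \<in> box2 a1 b1 a2 b2 \<longrightarrow> u x \<in> \<int>) \<longrightarrow> (\<forall>x. m x \<in> \<int>))"
proof -
  let ?\<Omega> = "box2 a1 b1 a2 b2" and ?E = "E_lim \<theta>1 \<theta>2 \<rho> a1 b1 a2 b2 u"
  let ?p = "\<theta>1 + \<theta>2"
  \<comment> \<open>Extension by 0 gives an integrable function on the whole plane, so that
    translations make sense, and bounded support, so that lattice sums are finite.\<close>
  define U where "U x = indicator ?\<Omega> x * u x" for x
  have U_in: "U x = u x" if "x \<in> ?\<Omega>" for x using that by (simp add: U_def)
  have U_out: "U x = 0" if "x \<notin> ?\<Omega>" for x using that by (simp add: U_def)
  have \<Omega>_bounded: "bounded ?\<Omega>"
    by (auto simp: box2_def intro!: bounded_Times)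
  have \<Omega>_open: "open ?\<Omega>"
    by (auto simp: box2_def intro!: open_Times)
  have U_int: "integrable lborel U"
  proof (rule Bochner_Integration.integrable_bound)
    have "emeasure lborel ?\<Omega> < \<infinity>"
      by (rule emeasure_bounded_finite[OF \<Omega>_bounded])
    then show "integrable lborel (\<lambda>x. indicator ?\<Omega> x * B)"
      using \<Omega>_open by (intro integrable_mult_left integrable_real_indicator) auto
    show "U \<in> borel_measurable lborel"
      using u(1) by (simp add: set_borel_measurable_def U_def[abs_def])
    show "AE x in lborel. norm (U x) \<le> norm (indicator ?\<Omega> x * B)"
      using u(2) by eventually_elim (auto simp: U_def indicator_def)
  qed
  obtain e where e: "?E = ennreal e" "e \<ge> 0"
    using E by (cases ?E) auto
  \<comment> \<open>The null set is fixed before any lattice is chosen, so the same atoms serve the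
    general and the integer-valued case; if \<open>u\<close> is not integer-valued, the empty set
    does.\<close>
  obtain N where N: "N \<in> null_sets lborel"
    "\<And>x. AE x in lborel. x \<in> ?\<Omega> \<longrightarrow> u x \<in> \<int> \<Longrightarrow> x \<in> ?\<Omega> \<Longrightarrow> x \<notin> N \<Longrightarrow> u x \<in> \<int>"
  proof (cases "AE x in lborel. x \<in> ?\<Omega> \<longrightarrow> u x \<in> \<int>")
    case True
    then obtain N where "N \<in> null_sets lborel" "{x \<in> space lborel. \<not> (x \<in> ?\<Omega> \<longrightarrow> u x \<in> \<int>)} \<subseteq> N"
      by (auto simp: eventually_ae_filter)
    then show ?thesis using that[of N] by auto
  next
    case False
    then show ?thesis using that[of "{}"] by auto
  qed
  define r where "r k = inverse (real (Suc k))" for k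
  have r: "r k > 0" for k by (simp add: r_def)
  have r_lim: "r \<longlonglongrightarrow> 0"
    unfolding r_def[abs_def] by (rule LIMSEQ_inverse_real_of_nat)
  \<comment> \<open>\<open>r k\<close> bounds three things at once: the scale, the translation
    modulus and the excess over the liminf. Values at most \<open>e + r k\<close> occur at
    arbitrarily small \<epsilon>, as otherwise the liminf would be at least
    \<open>e + r k\<close>.\<close>
  have "\<exists>\<epsilon>>0. \<epsilon> < r k \<and> (\<forall>t. norm t \<le> 2 * \<epsilon> \<longrightarrow> L1_modulus U t \<le> ennreal (r k)) \<and>
      E_eps \<theta>1 \<theta>2 \<rho> a1 b1 a2 b2 u \<epsilon> \<le> ennreal (e + r k)" for k
  proof -
    obtain d where d: "d > 0" "\<And>t. norm t < d \<Longrightarrow> L1_modulus U t \<le> ennreal (r k)"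
      using L1_modulus_uniform[OF U_int r] by blast
    let ?G = "E_eps \<theta>1 \<theta>2 \<rho> a1 b1 a2 b2 u"
    have "\<exists>\<^sub>F \<epsilon> in at_right 0. ?G \<epsilon> \<le> ennreal (e + r k)"
    proof (rule ccontr)
      assume "\<not> ?thesis"
      then have "\<forall>\<^sub>F \<epsilon> in at_right 0. ennreal (e + r k) \<le> ?G \<epsilon>"
        by (auto simp: not_frequently elim!: eventually_mono)
      then have "ennreal (e + r k) \<le> ?E"
        unfolding E_lim_def by (rule Liminf_bounded)
      then show False
        using e r[of k] by (simp add: ennreal_le_iff)
    qed
    moreover have "\<forall>\<^sub>F \<epsilon> in at_right 0. 0 < \<epsilon> \<and> \<epsilon> < min (r k) (d / 2)"
      unfolding eventually_at_right_field using r[of k] d(1) by (intro exI[of _ "min (r k) (d / 2)"]) auto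
    ultimately have "\<exists>\<^sub>F \<epsilon> in at_right 0. ?G \<epsilon> \<le> ennreal (e + r k) \<and> (0 < \<epsilon> \<and> \<epsilon> < min (r k) (d / 2))"
      by (rule frequently_eventually_frequently)
    from frequently_ex[OF this] obtain \<epsilon> where "?G \<epsilon> \<le> ennreal (e + r k)" "0 < \<epsilon>" "\<epsilon> < min (r k) (d / 2)"
      by blast
    then show ?thesis using d(2) by (intro exI[of _ \<epsilon>]) auto
  qed
  then have "\<forall>k. \<exists>\<epsilon>. \<epsilon> > 0 \<and> \<epsilon> < r k \<and> (\<forall>t. norm t \<le> 2 * \<epsilon> \<longrightarrow> L1_modulus U t \<le> ennreal (r k)) \<and>
      E_eps \<theta>1 \<theta>2 \<rho> a1 b1 a2 b2 u \<epsilon> \<le> ennreal (e + r k)"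
    by blast
  from choice[OF this] obtain \<epsilon> where \<epsilon>: "\<And>k. \<epsilon> k > 0" "\<And>k. \<epsilon> k < r k"
      "\<And>k t. norm t \<le> 2 * \<epsilon> k \<Longrightarrow> L1_modulus U t \<le> ennreal (r k)"
      "\<And>k. E_eps \<theta>1 \<theta>2 \<rho> a1 b1 a2 b2 u (\<epsilon> k) \<le> ennreal (e + r k)"
    by blast
  have *: "\<exists>(S :: (int \<times> int) set) w P. finite S \<and> (\<Sum>p\<in>S. \<bar>w p\<bar> powr ?p) \<le> 48 / (\<kappa> * c) * (e + r k) \<and>
    (\<forall>p\<in>S. P p \<in> ?\<Omega>) \<and>
    ((\<forall>x\<in>?\<Omega>. x \<notin> N \<longrightarrow> u x \<in> \<int>) \<longrightarrow> (\<forall>p\<in>S. w p \<in> \<int>)) \<and>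
    (\<forall>\<phi> M. smooth2 \<phi> \<longrightarrow> integrable lborel (pds [True, False] \<phi>) \<longrightarrow> M > 0 \<longrightarrow>
       (\<forall>x. \<bar>pds [True, False] \<phi> x\<bar> \<le> M) \<longrightarrow>
       (\<forall>x s t. \<phi> x \<noteq> 0 \<longrightarrow> \<bar>s\<bar> \<le> \<epsilon> k \<longrightarrow> \<bar>t\<bar> \<le> \<epsilon> k \<longrightarrow> x + (s, t) \<in> inner_box a1 b1 a2 b2 (\<epsilon> k)) \<longrightarrow>
       \<bar>(\<integral>x. U x * pds [True, False] \<phi> x \<partial>lborel) - (\<Sum>p\<in>S. w p * \<phi> (P p))\<bar> \<le> M * (3 * r k))"
    (is "\<exists>S w P. ?Q k S w P") for k
  proof -
    \<comment> \<open>The excess keeps the bound positive even when the energy is 0.\<close>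
    have L: "e + r k > 0" using e(2) r[of k] by simp
    show ?thesis
    proof (rule approximating_atoms[where \<rho> = \<rho> and u = u and U = U and \<epsilon> = "\<epsilon> k" and \<eta> = "r k" and N = N, OF \<theta>(1,2) less_imp_le[OF \<theta>(3)] \<rho>_meas \<rho> c \<epsilon>(1)[of k] U_int U_in U_out L \<epsilon>(4) r \<epsilon>(3) N(1)], goal_cases)
      case (6 S w P)
      have "?Q k S w P"
      proof (intro conjI impI allI ballI)
        show "finite S" by (rule 6(1))
        show "(\<Sum>p\<in>S. \<bar>w p\<bar> powr ?p) \<le> 48 / (\<kappa> * c) * (e + r k)" by (rule 6(2))
        show "P p \<in> ?\<Omega>" if "p \<in> S" for p using that by (rule 6(3))
        show "w p \<in> \<int>" if "\<forall>x\<in>?\<Omega>. x \<notin> N \<longrightarrow> u x \<in> \<int>" "p \<in> S" for p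
          by (rule 6(4)[OF that(2)]) (use that(1) in blast)
      next
        fix \<phi> M
        assume "smooth2 \<phi>" "integrable lborel (pds [True, False] \<phi>)" "M > 0"
          "\<forall>x. \<bar>pds [True, False] \<phi> x\<bar> \<le> M"
          "\<forall>x s t. \<phi> x \<noteq> 0 \<longrightarrow> \<bar>s\<bar> \<le> \<epsilon> k \<longrightarrow> \<bar>t\<bar> \<le> \<epsilon> k \<longrightarrow> x + (s, t) \<in> inner_box a1 b1 a2 b2 (\<epsilon> k)"
        then show "\<bar>(\<integral>x. U x * pds [True, False] \<phi> x \<partial>lborel) - (\<Sum>p\<in>S. w p * \<phi> (P p))\<bar> \<le> M * (3 * r k)"
          by (intro 6(5); blast)
      qed
      then show ?case by blast
    qed
  qed
  obtain S :: "nat \<Rightarrow> (int \<times> int) set" and w P where at: "\<And>k. ?Q k (S k) (w k) (P k)"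
  proof -
    assume found: "\<And>S w P. (\<And>k. ?Q k (S k) (w k) (P k)) \<Longrightarrow> thesis"
    from choice[OF allI[OF *]] obtain S where "\<forall>k. \<exists>w P. ?Q k (S k) w P" ..
    from choice[OF this] obtain w where "\<forall>k. \<exists>P. ?Q k (S k) (w k) P" ..
    from choice[OF this] obtain P where "\<forall>k. ?Q k (S k) (w k) (P k)" ..
    then show thesis using found by blast
  qed
  have K_lim: "(\<lambda>k. 48 / (\<kappa> * c) * (e + r k)) \<longlonglongrightarrow> 48 / (\<kappa> * c) * e"
    using tendsto_mult[OF tendsto_const[of "48 / (\<kappa> * c)"] tendsto_add[OF tendsto_const[of e] r_lim]]
    by (simp only: add_0_right)
  have conv: "(\<lambda>k. \<Sum>p\<in>S k. w k p * \<phi> (P k p)) \<longlonglongrightarrow> (\<integral>x. U x * pds [True, False] \<phi> x \<partial>lborel)"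
    if \<phi>: "test_fun ?\<Omega> \<phi>" for \<phi>
  proof -
    obtain K M where K: "compact K" "K \<subseteq> ?\<Omega>" "\<And>x. x \<notin> K \<Longrightarrow> \<phi> x = 0"
      "\<And>x. x \<notin> K \<Longrightarrow> pds [True, False] \<phi> x = 0" and M: "M > 0" "\<And>x. \<bar>pds [True, False] \<phi> x\<bar> \<le> M"
      and cont: "continuous_on UNIV (pds [True, False] \<phi>)"
      using test_fun_cases[OF \<phi>] by metis
    have sm: "smooth2 \<phi>" using \<phi> by (simp add: test_fun_def)
    have "(\<lambda>x. indicator K x *\<^sub>R pds [True, False] \<phi> x) = pds [True, False] \<phi>"
    proof (rule ext)
      show "indicator K x *\<^sub>R pds [True, False] \<phi> x = pds [True, False] \<phi> x" for x
        using K(4)[of x] by (cases "x \<in> K") (simp_all del: pds.simps)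
    qed
    then have int: "integrable lborel (pds [True, False] \<phi>)"
      using borel_integrable_compact[OF K(1) continuous_on_subset[OF cont subset_UNIV]] by (simp only:)
    obtain d where d: "d > 0" "\<And>x s t \<epsilon>. x \<in> K \<Longrightarrow> 0 \<le> \<epsilon> \<Longrightarrow> \<bar>s\<bar> + \<epsilon> < d \<Longrightarrow> \<bar>t\<bar> + \<epsilon> < d \<Longrightarrow>
        x + (s, t) \<in> inner_box a1 b1 a2 b2 \<epsilon>"
      using compact_in_inner_box[OF K(1,2)] by blast
    have "\<forall>\<^sub>F k in sequentially. r k < d / 2"
      using r_lim d(1) by (intro order_tendstoD) auto
    then have "\<forall>\<^sub>F k in sequentially. norm ((\<Sum>p\<in>S k. w k p * \<phi> (P k p)) - (\<integral>x. U x * pds [True, False] \<phi> x \<partial>lborel)) \<le> M * (3 * r k)"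
    proof eventually_elim
      case (elim k)
      \<comment> \<open>The shift and the inner margin are each at most \<open>\<epsilon> k\<close>,
        which is below \<open>d / 2\<close>; together they stay below \<open>d\<close>.\<close>
      have "x + (s, t) \<in> inner_box a1 b1 a2 b2 (\<epsilon> k)" if "\<phi> x \<noteq> 0" "\<bar>s\<bar> \<le> \<epsilon> k" "\<bar>t\<bar> \<le> \<epsilon> k" for x s t
        using that K(3)[of x] \<epsilon>(1,2)[of k] elim by (intro d(2)) auto
      then have "\<bar>(\<integral>x. U x * pds [True, False] \<phi> x \<partial>lborel) - (\<Sum>p\<in>S k. w k p * \<phi> (P k p))\<bar> \<le> M * (3 * r k)"
        using at[of k] sm int M by blast
      then show ?case by (simp add: abs_minus_commute)
    qed
    moreover have "(\<lambda>k. M * (3 * r k)) \<longlonglongrightarrow> 0"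
      using tendsto_mult[OF tendsto_const[of "M * 3"] r_lim] by (simp add: mult.assoc)
    ultimately have "(\<lambda>k. (\<Sum>p\<in>S k. w k p * \<phi> (P k p)) - (\<integral>x. U x * pds [True, False] \<phi> x \<partial>lborel)) \<longlonglongrightarrow> 0"
      by (rule Lim_null_comparison)
    then show ?thesis by (simp add: LIM_zero_iff)
  qed
  have p01: "0 < ?p" "?p < 1" using \<theta> by auto
  have fin: "finite (S k)" and K_bound: "(\<Sum>p\<in>S k. \<bar>w k p\<bar> powr ?p) \<le> 48 / (\<kappa> * c) * (e + r k)" for k
    using at[of k] by blast+
  have P_in: "P k i \<in> ?\<Omega>" if "i \<in> S k" for k i
    using at[of k] that by blast
  obtain a :: "nat \<Rightarrow> real" and q :: "nat \<Rightarrow> real \<times> real" where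
    a: "summable (\<lambda>j. \<bar>a j\<bar>)" "summable (\<lambda>j. \<bar>a j\<bar> powr ?p)" "(\<Sum>j. \<bar>a j\<bar> powr ?p) \<le> 48 / (\<kappa> * c) * e"
    and lim: "\<And>\<phi> l M. continuous_on UNIV \<phi> \<Longrightarrow> (\<And>x. \<bar>\<phi> x\<bar> \<le> M) \<Longrightarrow>
       (\<lambda>k. \<Sum>i\<in>S k. w k i * \<phi> (P k i)) \<longlonglongrightarrow> l \<Longrightarrow> (\<Sum>j. a j * \<phi> (q j)) = l"
    and a_int: "\<And>j. (\<And>k i. i \<in> S k \<Longrightarrow> w k i \<in> \<int>) \<Longrightarrow> a j \<in> \<int>"
  proof (rule atomic_weak_limit[where S = S and w = w and P = P, OF p01 fin K_bound K_lim \<Omega>_bounded P_in], goal_cases)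
    case (2 a q)
    show ?case by (rule that[of a q]) (fact 2)+
  qed
  obtain m :: "real \<times> real \<Rightarrow> real" where
    m: "countable {x. m x \<noteq> 0}" "{x. m x \<noteq> 0} \<subseteq> ?\<Omega>"
    and m_sum: "\<And>\<phi> M. (\<And>x. \<bar>\<phi> x\<bar> \<le> M) \<Longrightarrow> (\<And>x. x \<notin> ?\<Omega> \<Longrightarrow> \<phi> x = 0) \<Longrightarrow>
       (\<Sum>\<^sub>\<infinity>x. m x * \<phi> x) = (\<Sum>j. a j * \<phi> (q j))"
    and m_p: "(\<lambda>x. \<bar>m x\<bar> powr ?p) summable_on UNIV" "(\<Sum>\<^sub>\<infinity>x. \<bar>m x\<bar> powr ?p) \<le> (\<Sum>j. \<bar>a j\<bar> powr ?p)"
    and m_int: "\<And>x. (\<And>j. a j \<in> \<int>) \<Longrightarrow> m x \<in> \<int>"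
  proof (rule merge_atoms[where \<Omega> = ?\<Omega> and q = q, OF p01(1) less_imp_le[OF p01(2)] a(1,2)], goal_cases)
    case (1 m)
    show ?case by (rule that[of m]) (fact 1)+
  qed
  have "(\<integral>x. indicator ?\<Omega> x * u x * pds [True, False] \<phi> x \<partial>lborel) = (\<Sum>\<^sub>\<infinity>x. m x * \<phi> x)"
    if \<phi>: "test_fun ?\<Omega> \<phi>" for \<phi>
  proof -
    obtain K M where K: "K \<subseteq> ?\<Omega>" "\<And>x. x \<notin> K \<Longrightarrow> \<phi> x = 0" "\<And>x. \<bar>\<phi> x\<bar> \<le> M" "continuous_on UNIV \<phi>"
      using test_fun_cases[OF \<phi>] by metis
    have "(\<Sum>\<^sub>\<infinity>x. m x * \<phi> x) = (\<Sum>j. a j * \<phi> (q j))"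
      using K by (intro m_sum[of \<phi> M]) auto
    also have "\<dots> = (\<integral>x. U x * pds [True, False] \<phi> x \<partial>lborel)"
      by (rule lim[OF K(4,3) conv[OF \<phi>]])
    finally show ?thesis by (simp only: U_def)
  qed
  moreover have "ennreal (\<Sum>\<^sub>\<infinity>x. \<bar>m x\<bar> powr ?p) \<le> ennreal (48 / (\<kappa> * c)) * ?E"
  proof -
    have "ennreal (\<Sum>\<^sub>\<infinity>x. \<bar>m x\<bar> powr ?p) \<le> ennreal (48 / (\<kappa> * c) * e)"
      using m_p(2) a(3) by (intro ennreal_leI) linarith
    also have "\<dots> = ennreal (48 / (\<kappa> * c)) * ?E"
      unfolding e(1) by (rule ennreal_mult) (use c e(2) in simp_all)
    finally show ?thesis .
  qed
  moreover have "m x \<in> \<int>" if int: "AE x in lborel. x \<in> ?\<Omega> \<longrightarrow> u x \<in> \<int>" for x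
  proof (rule m_int[OF a_int])
    show "w k i \<in> \<int>" if "i \<in> S k" for k i
      using at[of k] N(2)[OF int] that by blast
  qed
  ultimately show ?thesis
    using m m_p(1) by (intro exI[of _ m]) blast
qed

theorem theorem1p3:
  fixes \<theta>1 \<theta>2 :: real and \<rho> :: "real \<times> real \<Rightarrow> real"
  assumes "\<theta>1 > 0" and "\<theta>2 > 0" and "\<theta>1 + \<theta>2 < 1"
    and "\<rho> \<in> borel_measurable lborel" and "integrable lborel \<rho>"
    and "\<forall>z. \<rho> z \<ge> 0"
    and "\<forall>z w. norm z = norm w \<longrightarrow> \<rho> z = \<rho> w"
    and "\<forall>z. norm z > 1 \<longrightarrow> \<rho> z = 0"
    and "(\<integral>z. \<rho> z \<partial>lborel) = 1"
  shows "\<exists>C>0. \<forall>a1 b1 a2 b2 :: real. \<forall>u :: real \<times> real \<Rightarrow> real.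
     a1 < b1 \<longrightarrow> a2 < b2 \<longrightarrow>
     set_borel_measurable lborel (box2 a1 b1 a2 b2) u \<longrightarrow>
     (\<exists>B. AE x in lborel. x \<in> box2 a1 b1 a2 b2 \<longrightarrow> \<bar>u x\<bar> \<le> B) \<longrightarrow>
     E_lim \<theta>1 \<theta>2 \<rho> a1 b1 a2 b2 u < \<infinity> \<longrightarrow>
     (\<exists>m :: real \<times> real \<Rightarrow> real.
        countable {x. m x \<noteq> 0} \<and> {x. m x \<noteq> 0} \<subseteq> box2 a1 b1 a2 b2 \<and>
        (\<forall>\<phi>. test_fun (box2 a1 b1 a2 b2) \<phi> \<longrightarrow>
           (\<integral>x. indicator (box2 a1 b1 a2 b2) x * u x * pds [True, False] \<phi> x \<partial>lborel)
             = (\<Sum>\<^sub>\<infinity>x. m x * \<phi> x)) \<and>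
        (\<lambda>x. \<bar>m x\<bar> powr (\<theta>1 + \<theta>2)) summable_on UNIV \<and>
        ennreal (\<Sum>\<^sub>\<infinity>x. \<bar>m x\<bar> powr (\<theta>1 + \<theta>2)) \<le> ennreal C * E_lim \<theta>1 \<theta>2 \<rho> a1 b1 a2 b2 u \<and>
        ((AE x in lborel. x \<in> box2 a1 b1 a2 b2 \<longrightarrow> u x \<in> \<int>) \<longrightarrow> (\<forall>x. m x \<in> \<int>)))"
proof -
  have \<rho>_meas: "\<rho> \<in> borel_measurable borel"
    using assms(4) by simp
  have "(\<integral>\<^sup>+z. ennreal (\<rho> z) \<partial>lborel) = ennreal 1"
    using assms(5,6,9) by (subst nn_integral_eq_integral) auto
  then have "(\<integral>\<^sup>+z. ennreal (\<rho> z) \<partial>lborel) \<noteq> 0"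
    by simp
  \<comment> \<open>Both numbers come from \<rho> alone, before the box and \<open>u\<close> are
    introduced; hence \<open>48 / (\<kappa> * c)\<close> is uniform in them.\<close>
  then obtain c \<kappa> where c: "c > 0" "\<kappa> > 0"
    "ennreal \<kappa> \<le> (\<integral>\<^sup>+z. indicator (diagonal_cone c) z * ennreal (\<rho> z) \<partial>lborel)"
    using diagonal_cone_mass[OF \<rho>_meas] by blast
  show ?thesis
  proof (rule exI[of _ "48 / (\<kappa> * c)"], intro conjI allI impI)
    show "0 < 48 / (\<kappa> * c)"
      using c by simp
  next
    fix a1 b1 a2 b2 :: real and u :: "real \<times> real \<Rightarrow> real"
    assume u: "set_borel_measurable lborel (box2 a1 b1 a2 b2) u"
      "\<exists>B. AE x in lborel. x \<in> box2 a1 b1 a2 b2 \<longrightarrow> \<bar>u x\<bar> \<le> B"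
      "E_lim \<theta>1 \<theta>2 \<rho> a1 b1 a2 b2 u < \<infinity>"
    from u(2) obtain B where B: "AE x in lborel. x \<in> box2 a1 b1 a2 b2 \<longrightarrow> \<bar>u x\<bar> \<le> B" ..
    have \<rho>: "\<rho> z \<ge> 0" "norm z > 1 \<Longrightarrow> \<rho> z = 0" "norm z = norm w \<Longrightarrow> \<rho> z = \<rho> w" for z w
      using assms(6,7,8) by blast+
    show "\<exists>m :: real \<times> real \<Rightarrow> real.
        countable {x. m x \<noteq> 0} \<and> {x. m x \<noteq> 0} \<subseteq> box2 a1 b1 a2 b2 \<and>
        (\<forall>\<phi>. test_fun (box2 a1 b1 a2 b2) \<phi> \<longrightarrow>
           (\<integral>x. indicator (box2 a1 b1 a2 b2) x * u x * pds [True, False] \<phi> x \<partial>lborel)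
             = (\<Sum>\<^sub>\<infinity>x. m x * \<phi> x)) \<and>
        (\<lambda>x. \<bar>m x\<bar> powr (\<theta>1 + \<theta>2)) summable_on UNIV \<and>
        ennreal (\<Sum>\<^sub>\<infinity>x. \<bar>m x\<bar> powr (\<theta>1 + \<theta>2)) \<le> ennreal (48 / (\<kappa> * c)) * E_lim \<theta>1 \<theta>2 \<rho> a1 b1 a2 b2 u \<and>
        ((AE x in lborel. x \<in> box2 a1 b1 a2 b2 \<longrightarrow> u x \<in> \<int>) \<longrightarrow> (\<forall>x. m x \<in> \<int>))"
      by (rule finite_energy_atomic[OF assms(1-3) \<rho>_meas \<rho> c u(1) B u(3)])
  qed
qed

end
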